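(* Let $\Lambda\in\mathfrak{L}$, and let $A\in\mathrm{GL}_n(K_\Lambda)$, $B\in\mathfrak{gl}_n(K_\Lambda)$ satisfy the consistency relation $q\,\phi(B)=ABA^{-1}+\partial(A)A^{-1}$. Let $U\in\mathrm{GL}_n(M)$ be a fundamental matrix of $\partial y=By$, i.e. an invertible matrix of meromorphic functions on $\mathbb{C}$ with $\partial U=BU$. Then all entries of $U$ lie in $S_0=K[z,\zeta(z,\Lambda)]$.
   Context: Fix a lattice $\Lambda_0\subset\mathbb{C}$, let $\mathfrak{L}$ be its commensurability class, $K_\Lambda$ the field of $\Lambda$-periodic meromorphic functions on $\mathbb{C}$, $K=\bigcup_{\Lambda\in\mathfrak{L}}K_\Lambda$, and $M$ the field of all meromorphic functions on $\mathbb{C}$. Fix an integer $q\ge2$; $\phi f(z)=f(qz)$ (applied entrywise to matrices), $\partial=d/dz$. $\zeta(z,\Lambda)$ is the Weierstrass zeta function of $\Lambda$; the ring $K[z,\zeta(z,\Lambda)]$ does not depend on the choice of $\Lambda\in\mathfrak{L}$. *)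

theory Defs
  imports "HOL-Complex_Analysis.Complex_Analysis"
begin

no_notation fps_nth (infixl \<open>$\<close> 75)

section \<open>The field of meromorphic functions on the complex plane\<close>

text \<open>
  A meromorphic function in the sense of \<open>HOL-Complex_Analysis\<close> is a total function whose values at
  poles and at removable singularities are irrelevant. Identifying functions that agree outside a
  closed discrete set (the filter \<open>cosparse UNIV\<close>) gives the field $M$ of meromorphic functions
  on $\mathbb{C}$.
\<close>

definition mero_rel :: "(complex \<Rightarrow> complex) \<Rightarrow> (complex \<Rightarrow> complex) \<Rightarrow> bool" where
  "mero_rel f g \<longleftrightarrow>
     f meromorphic_on UNIV \<and> g meromorphic_on UNIV \<and> (\<forall>\<^sub>\<approx>z\<in>UNIV. f z = g z)"

lemma mero_rel_refl_iff: "mero_rel f f \<longleftrightarrow> f meromorphic_on UNIV"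
  by (simp add: mero_rel_def)

lemma mero_relD:
  assumes "mero_rel f g"
  shows "f meromorphic_on UNIV" "g meromorphic_on UNIV" "\<forall>\<^sub>\<approx>z\<in>UNIV. f z = g z"
  using assms by (auto simp: mero_rel_def)

lemma mero_relI:
  assumes "f meromorphic_on UNIV" "g meromorphic_on UNIV" "\<forall>\<^sub>\<approx>z\<in>UNIV. f z = g z"
  shows "mero_rel f g"
  using assms by (simp add: mero_rel_def)

lemma mero_rel_unop:
  assumes "mero_rel f g" and "\<And>f. f meromorphic_on UNIV \<Longrightarrow> (\<lambda>z. h (f z)) meromorphic_on UNIV"
  shows "mero_rel (\<lambda>z. h (f z)) (\<lambda>z. h (g z))"
  using mero_relD[OF assms(1)] by (intro mero_relI assms(2)) (auto elim!: eventually_mono)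

lemma mero_rel_binop:
  assumes "mero_rel f1 g1" "mero_rel f2 g2"
    and "\<And>f g. f meromorphic_on UNIV \<Longrightarrow> g meromorphic_on UNIV \<Longrightarrow>
           (\<lambda>z. h (f z) (g z)) meromorphic_on UNIV"
  shows "mero_rel (\<lambda>z. h (f1 z) (f2 z)) (\<lambda>z. h (g1 z) (g2 z))"
proof (intro mero_relI assms(3))
  show "\<forall>\<^sub>\<approx>z\<in>UNIV. h (f1 z) (f2 z) = h (g1 z) (g2 z)"
    using mero_relD(3)[OF assms(1)] mero_relD(3)[OF assms(2)] by eventually_elim simp
qed (use assms(1,2) in \<open>auto dest: mero_relD\<close>)

lemma part_equivp_mero_rel: "part_equivp mero_rel"
proof (rule part_equivpI)
  show "\<exists>f. mero_rel f f"
    by (rule exI[of _ "\<lambda>_. 0"]) (auto simp: mero_rel_refl_iff)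
  show "symp mero_rel"
    by (rule sympI) (auto simp: mero_rel_def eq_commute)
  show "transp mero_rel"
  proof (rule transpI)
    fix f g h assume fg: "mero_rel f g" and gh: "mero_rel g h"
    have "\<forall>\<^sub>\<approx>z\<in>UNIV. f z = h z"
      using mero_relD(3)[OF fg] mero_relD(3)[OF gh] by eventually_elim simp
    thus "mero_rel f h"
      using fg gh by (auto simp: mero_rel_def)
  qed
qed

quotient_type mero = "complex \<Rightarrow> complex" / partial: mero_rel
  by (rule part_equivp_mero_rel)

instantiation mero :: field
begin

lift_definition zero_mero :: mero is "\<lambda>_. 0"
  by (auto simp: mero_rel_def)

lift_definition one_mero :: mero is "\<lambda>_. 1"
  by (auto simp: mero_rel_def)

lift_definition plus_mero :: "mero \<Rightarrow> mero \<Rightarrow> mero" is "\<lambda>f g z. f z + g z"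
  by (rule mero_rel_binop) (auto intro!: meromorphic_intros)

lift_definition uminus_mero :: "mero \<Rightarrow> mero" is "\<lambda>f z. - f z"
  by (rule mero_rel_unop) (auto intro!: meromorphic_intros)

lift_definition minus_mero :: "mero \<Rightarrow> mero \<Rightarrow> mero" is "\<lambda>f g z. f z - g z"
  by (rule mero_rel_binop) (auto intro!: meromorphic_intros)

lift_definition times_mero :: "mero \<Rightarrow> mero \<Rightarrow> mero" is "\<lambda>f g z. f z * g z"
  by (rule mero_rel_binop) (auto intro!: meromorphic_intros)

lift_definition inverse_mero :: "mero \<Rightarrow> mero" is "\<lambda>f z. inverse (f z)"
  by (rule mero_rel_unop) (auto intro!: meromorphic_intros)

lift_definition divide_mero :: "mero \<Rightarrow> mero \<Rightarrow> mero" is "\<lambda>f g z. f z / g z"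
  by (rule mero_rel_binop) (auto intro!: meromorphic_intros)

instance
proof
  show "(0::mero) \<noteq> 1"
    by transfer (auto simp: mero_rel_def)
next
  fix a :: mero
  show "a \<noteq> 0 \<Longrightarrow> inverse a * a = 1"
  proof transfer
    fix f :: "complex \<Rightarrow> complex"
    assume "mero_rel f f" and "\<not> mero_rel f (\<lambda>_. 0)"
    hence f: "f meromorphic_on UNIV" and "\<not> (\<forall>\<^sub>\<approx>z\<in>UNIV. f z = 0)"
      by (auto simp: mero_rel_def)
    with meromorphic_imp_constant_or_avoid[OF f, of 0] have "\<forall>\<^sub>\<approx>z\<in>UNIV. f z \<noteq> 0"
      by auto
    thus "mero_rel (\<lambda>z. inverse (f z) * f z) (\<lambda>_. 1)"
      using f by (intro mero_relI) (auto intro!: meromorphic_intros elim!: eventually_mono)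
  qed
qed (transfer;
     auto simp: mero_rel_def algebra_simps divide_inverse intro!: meromorphic_intros)+

end

lift_definition mero_const :: "complex \<Rightarrow> mero" is "\<lambda>c _. c"
  by (auto simp: mero_rel_def)

lift_definition mero_id :: mero is "\<lambda>z. z"
  by (auto simp: mero_rel_def)

lift_definition mero_deriv :: "mero \<Rightarrow> mero" is deriv
proof -
  fix f g :: "complex \<Rightarrow> complex"
  assume fg: "mero_rel f g"
  have "\<forall>\<^sub>F w in at z. deriv f w = deriv g w" for z
  proof -
    have "\<forall>\<^sub>F w in at z. f w = g w"
      using mero_relD(3)[OF fg] by (simp add: eventually_cosparse_open_eq)
    then obtain S where S: "open S" "z \<in> S" "\<And>w. w \<in> S \<Longrightarrow> w \<noteq> z \<Longrightarrow> f w = g w"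
      by (auto simp: eventually_at_topological)
    have "\<forall>\<^sub>F w in at z. w \<in> S - {z}"
      using S by (intro eventually_at_in_open) auto
    hence "\<forall>\<^sub>F w in at z. \<forall>\<^sub>F u in nhds w. f u = g u"
    proof eventually_elim
      case (elim w)
      show ?case
        using S elim by (intro eventually_nhds_in_open[of "S - {z}", THEN eventually_mono]) auto
    qed
    thus ?thesis
      by eventually_elim (auto intro: deriv_cong_ev)
  qed
  thus "mero_rel (deriv f) (deriv g)"
    using mero_relD(1,2)[OF fg]
    by (auto simp: mero_rel_def eventually_cosparse_open_eq intro!: meromorphic_intros)
qed

lemma mero_rel_affine:
  assumes "mero_rel f g" "c \<noteq> 0"
  shows "mero_rel (\<lambda>z. f (c * z + a)) (\<lambda>z. g (c * z + a))"
proof -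
  have "\<forall>\<^sub>F w in at z. f (c * w + a) = g (c * w + a)" for z
  proof -
    have "\<forall>\<^sub>F u in at (c * z + a). f u = g u"
      using mero_relD(3)[OF assms(1)] by (simp add: eventually_cosparse_open_eq)
    moreover have "filterlim (\<lambda>w. c * w + a) (at (c * z + a)) (at z)"
      using assms(2)
      by (intro filterlim_atI tendsto_intros) (auto simp: eventually_at_filter)
    ultimately show ?thesis
      by (rule eventually_compose_filterlim)
  qed
  hence "\<forall>\<^sub>\<approx>z\<in>UNIV. f (c * z + a) = g (c * z + a)"
    by (simp add: eventually_cosparse_open_eq)
  moreover have "(\<lambda>z. h (c * z + a)) meromorphic_on UNIV" if "h meromorphic_on UNIV" for h
    by (rule meromorphic_on_compose[OF that]) (auto intro!: analytic_intros)
  ultimately show ?thesis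
    using mero_relD(1,2)[OF assms(1)] by (intro mero_relI)
qed

text \<open>
  The dilation $f(z) \mapsto f(cz)$. For \<open>c = 0\<close> this is not defined on all of $M$ (\<open>f\<close> may have
  a pole at 0), so a dummy value is used.
\<close>

lift_definition mero_dilate :: "complex \<Rightarrow> mero \<Rightarrow> mero" is
  "\<lambda>c f z. if c = 0 then 0 else f (c * z)"
  subgoal for c f g
    using mero_rel_affine[of f g c 0] by (cases "c = 0") (auto simp: mero_rel_def)
  done

lift_definition mero_shift :: "complex \<Rightarrow> mero \<Rightarrow> mero" is "\<lambda>a f z. f (z + a)"
  subgoal for a f g
    using mero_rel_affine[of f g 1 a] by simp
  done


section \<open>Lattices and elliptic functions\<close>

definition is_lattice :: "complex set \<Rightarrow> bool" where
  "is_lattice \<Lambda> \<longleftrightarrow>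
     (\<exists>\<omega>1 \<omega>2. \<omega>1 \<noteq> \<omega>2 \<and> independent {\<omega>1, \<omega>2} \<and>
        \<Lambda> = {of_int m * \<omega>1 + of_int n * \<omega>2 | m n. True})"

definition finite_index :: "complex set \<Rightarrow> complex set \<Rightarrow> bool" where
  "finite_index H G \<longleftrightarrow> H \<subseteq> G \<and> finite ((\<lambda>x. (+) x ` H) ` G)"

definition commensurable :: "complex set \<Rightarrow> complex set \<Rightarrow> bool" where
  "commensurable \<Lambda> \<Lambda>' \<longleftrightarrow> finite_index (\<Lambda> \<inter> \<Lambda>') \<Lambda> \<and> finite_index (\<Lambda> \<inter> \<Lambda>') \<Lambda>'"

definition commensurability_class :: "complex set \<Rightarrow> complex set set" where
  "commensurability_class \<Lambda>0 = {\<Lambda>. is_lattice \<Lambda> \<and> commensurable \<Lambda>0 \<Lambda>}"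

definition elliptic_field :: "complex set \<Rightarrow> mero set" where
  "elliptic_field \<Lambda> = {f. \<forall>\<omega>\<in>\<Lambda>. mero_shift \<omega> f = f}"

definition elliptic_field_union :: "complex set \<Rightarrow> mero set" where
  "elliptic_field_union \<Lambda>0 = (\<Union>\<Lambda>\<in>commensurability_class \<Lambda>0. elliptic_field \<Lambda>)"


section \<open>The Weierstrass zeta function\<close>

definition weierstrass_zeta :: "complex set \<Rightarrow> complex \<Rightarrow> complex" where
  "weierstrass_zeta \<Lambda> z =
     1 / z + (\<Sum>\<^sub>\<infinity>\<omega>\<in>\<Lambda> - {0}. 1 / (z - \<omega>) + 1 / \<omega> + z / \<omega>\<^sup>2)"

lemma is_latticeE:
  assumes "is_lattice \<Lambda>"
  obtains \<omega>1 \<omega>2 B where "\<Lambda> = (\<lambda>(m,n). of_int m * \<omega>1 + of_int n * \<omega>2) ` UNIV" and "B > 0"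
    and "\<And>x y :: real. B * norm (x, y) \<le> norm (of_real x * \<omega>1 + of_real y * \<omega>2)"
proof -
  obtain \<omega>1 \<omega>2 where *: "\<omega>1 \<noteq> \<omega>2" "independent {\<omega>1, \<omega>2}"
      "\<Lambda> = {of_int m * \<omega>1 + of_int n * \<omega>2 | m n. True}"
    using assms unfolding is_lattice_def by blast
  define T where "T = (\<lambda>(x::real, y::real). x *\<^sub>R \<omega>1 + y *\<^sub>R \<omega>2)"
  have lin: "linear T"
    by (rule linearI) (auto simp: T_def algebra_simps)
  have "inj T"
    unfolding linear_injective_0[OF lin]
  proof safe
    fix x y assume T0: "T (x, y) = 0"
    hence eq: "x *\<^sub>R \<omega>1 + y *\<^sub>R \<omega>2 = 0"
      by (simp add: T_def)
    have "(\<Sum>v\<in>{\<omega>1, \<omega>2}. (if v = \<omega>1 then x else y) *\<^sub>R v) = 0"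
      using eq *(1) by auto
    from real_vector.independentD[OF *(2) _ order.refl this]
    have "(if v = \<omega>1 then x else y) = 0" if "v \<in> {\<omega>1, \<omega>2}" for v
      using that by blast
    from this[of \<omega>1] this[of \<omega>2] have "x = 0" "y = 0"
      using *(1) by auto
    thus "(x, y) = 0"
      by (simp add: zero_prod_def)
  qed
  then obtain B where "B > 0" "\<And>p. B * norm p \<le> norm (T p)"
    using linear_inj_bounded_below_pos[OF lin] by blast
  thus ?thesis
    using *(3) by (intro that[of \<omega>1 \<omega>2 B]) (auto simp: T_def scaleR_conv_of_real)
qed

lemma summable_on_int_aux: "(\<lambda>m::int. (1 + real_of_int \<bar>m\<bar>) powr (-3/2)) summable_on UNIV"
proof -
  have "summable (\<lambda>n. real (Suc n) powr (-3/2))"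
    by (subst summable_Suc_iff) (simp add: summable_real_powr_iff)
  hence nat: "(\<lambda>n. (1 + real n) powr (-3/2)) summable_on UNIV"
    by (intro summable_nonneg_imp_summable_on) (auto simp: add.commute)
  have 1: "(\<lambda>m::int. (1 + real_of_int \<bar>m\<bar>) powr (-3/2)) summable_on range int"
    using nat by (subst summable_on_reindex) (auto simp: o_def inj_on_def)
  have 2: "(\<lambda>m::int. (1 + real_of_int \<bar>m\<bar>) powr (-3/2)) summable_on range (\<lambda>n. - int n)"
    using nat by (subst summable_on_reindex) (auto simp: o_def inj_on_def)
  have "(\<lambda>m::int. (1 + real_of_int \<bar>m\<bar>) powr (-3/2)) summable_on (range int \<union> range (\<lambda>n. - int n))"
    using 1 2 by (rule summable_on_union)
  also have "range int \<union> range (\<lambda>n. - int n) = UNIV"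
    by (auto simp: image_iff) (metis int_cases2)
  finally show ?thesis .
qed

lemma lattice_summable:
  assumes "is_lattice \<Lambda>"
  shows "(\<lambda>\<omega>. 1 / norm \<omega> ^ 3) summable_on (\<Lambda> - {0})"
proof -
  obtain \<omega>1 \<omega>2 B where L: "\<Lambda> = (\<lambda>(m,n). of_int m * \<omega>1 + of_int n * \<omega>2) ` UNIV" and B: "B > 0"
    and le: "\<And>x y :: real. B * norm (x, y) \<le> norm (of_real x * \<omega>1 + of_real y * \<omega>2)"
    using is_latticeE[OF assms] by metis
  define h where "h = (\<lambda>(m::int,n::int). of_int m * \<omega>1 + of_int n * \<omega>2)"
  define g where "g = (\<lambda>m::int. (1 + real_of_int \<bar>m\<bar>) powr (-3/2))"
  have h_le: "B * norm (real_of_int m, real_of_int n) \<le> norm (h (m, n))" for m n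
    using le[of "of_int m" "of_int n"] by (simp add: h_def)
  have h_0: "h p = 0 \<longleftrightarrow> p = (0, 0)" for p
    using h_le[of "fst p" "snd p"] B
    by (cases p) (auto simp: h_def mult_le_0_iff zero_prod_def)
  have inj: "inj h"
  proof (rule injI)
    fix p p' assume "h p = h p'"
    hence "h (fst p - fst p', snd p - snd p') = 0"
      by (simp add: h_def case_prod_unfold algebra_simps)
    thus "p = p'"
      by (auto simp: h_0 prod_eq_iff)
  qed
  have L': "\<Lambda> - {0} = h ` (UNIV - {(0, 0)})"
    using h_0 by (auto simp: L h_def[symmetric])
  have "(\<lambda>(m, n). g m * g n) summable_on UNIV \<times> UNIV"
  proof (rule summable_on_SigmaI)
    show "((\<lambda>n. case (m, n) of (m, n) \<Rightarrow> g m * g n) has_sum (g m * infsum g UNIV)) UNIV" for m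
      unfolding prod.case using summable_on_int_aux unfolding g_def
      by (intro has_sum_cmult_right has_sum_infsum)
    show "(\<lambda>m. g m * infsum g UNIV) summable_on UNIV"
      using summable_on_int_aux unfolding g_def by (intro summable_on_cmult_left)
  qed (auto simp: g_def)
  hence "(\<lambda>p. (8 / B ^ 3) * (case p of (m, n) \<Rightarrow> g m * g n)) summable_on UNIV"
    by (intro summable_on_cmult_right) simp
  hence "(\<lambda>p. (8 / B ^ 3) * (case p of (m, n) \<Rightarrow> g m * g n)) summable_on (UNIV - {(0, 0)})"
    by (rule summable_on_subset_banach) auto
  hence "(\<lambda>p. 1 / norm (h p) ^ 3) summable_on (UNIV - {(0, 0)})"
  proof (rule summable_on_comparison_test)
    fix p :: "int \<times> int" assume p: "p \<in> UNIV - {(0, 0)}"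
    obtain m n where [simp]: "p = (m, n)" by (cases p)
    define N where "N = norm (real_of_int m, real_of_int n)"
    have mN: "\<bar>real_of_int m\<bar> \<le> N" and nN: "\<bar>real_of_int n\<bar> \<le> N"
      unfolding N_def by (simp_all add: norm_Pair real_le_rsqrt)
    have "1 \<le> N"
    proof (cases "m = 0")
      case True
      thus ?thesis using p nN by simp
    next
      case False
      thus ?thesis using mN by linarith
    qed
    have "(1 + \<bar>real_of_int m\<bar>) * (1 + \<bar>real_of_int n\<bar>) \<le> (2 * N) * (2 * N)"
      using mN nN \<open>1 \<le> N\<close> by (intro mult_mono) auto
    hence "((2 * N) * (2 * N)) powr (-3/2) \<le> ((1 + \<bar>real_of_int m\<bar>) * (1 + \<bar>real_of_int n\<bar>)) powr (-3/2)"
      by (intro powr_mono2') auto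
    also have "\<dots> = g m * g n"
      by (simp add: g_def powr_mult)
    also have "((2 * N) * (2 * N)) = (2 * N) powr 2"
      using \<open>1 \<le> N\<close> by (simp add: power2_eq_square)
    also have "((2 * N) powr 2) powr (-3/2) = 1 / (8 * N ^ 3)"
    proof -
      have "((2 * N) powr 2) powr (-3/2) = (2 * N) powr (- real 3)"
        by (subst powr_powr) simp
      also have "\<dots> = inverse ((2 * N) ^ 3)"
        using \<open>1 \<le> N\<close> by (subst powr_minus, subst powr_realpow) auto
      finally show ?thesis by (simp add: field_simps)
    qed
    finally have gg: "1 / N ^ 3 \<le> 8 * (g m * g n)"
      using \<open>1 \<le> N\<close> by (simp add: field_simps)
    have "1 / norm (h p) ^ 3 \<le> 1 / (B * N) ^ 3"
    proof (rule divide_left_mono)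
      have "0 < B * N" "B * N \<le> norm (h p)"
        using h_le[of m n] B \<open>1 \<le> N\<close> by (simp_all add: N_def[symmetric])
      thus "(B * N) ^ 3 \<le> norm (h p) ^ 3" "0 < norm (h p) ^ 3 * (B * N) ^ 3"
        by (auto intro!: power_mono mult_pos_pos zero_less_power simp del: zero_less_norm_iff)
    qed auto
    also have "\<dots> = (1 / N ^ 3) / B ^ 3"
      by (simp add: power_mult_distrib)
    also have "\<dots> \<le> (8 * (g m * g n)) / B ^ 3"
      using gg B by (intro divide_right_mono) auto
    finally show "1 / norm (h p) ^ 3 \<le> (8 / B ^ 3) * (case p of (m, n) \<Rightarrow> g m * g n)"
      by simp
  qed auto
  thus ?thesis
    unfolding L' using inj
    by (subst summable_on_reindex) (auto simp: o_def intro: inj_on_subset)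
qed

lemma finite_lattice_cball:
  assumes "is_lattice \<Lambda>"
  shows "finite {\<omega>\<in>\<Lambda>. norm \<omega> \<le> r}"
proof -
  obtain \<omega>1 \<omega>2 B where L: "\<Lambda> = (\<lambda>(m,n). of_int m * \<omega>1 + of_int n * \<omega>2) ` UNIV" and B: "B > 0"
    and le: "\<And>x y :: real. B * norm (x, y) \<le> norm (of_real x * \<omega>1 + of_real y * \<omega>2)"
    using is_latticeE[OF assms] by metis
  define k where "k = \<lceil>r / B\<rceil>"
  have "{\<omega>\<in>\<Lambda>. norm \<omega> \<le> r} \<subseteq>
          (\<lambda>(m,n). of_int m * \<omega>1 + of_int n * \<omega>2) ` ({-k..k} \<times> {-k..k})"
  proof safe
    fix \<omega> assume "\<omega> \<in> \<Lambda>" and r: "norm \<omega> \<le> r"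
    then obtain m n where \<omega>: "\<omega> = of_int m * \<omega>1 + of_int n * \<omega>2"
      by (auto simp: L)
    have "B * norm (real_of_int m, real_of_int n) \<le> r"
      using le[of "of_int m" "of_int n"] r by (simp add: \<omega>)
    hence N: "norm (real_of_int m, real_of_int n) \<le> r / B"
      using B by (simp add: field_simps)
    have "\<bar>real_of_int m\<bar> \<le> r / B" "\<bar>real_of_int n\<bar> \<le> r / B"
      by (rule order.trans[OF _ N], simp add: norm_Pair real_le_rsqrt)+
    hence "\<bar>m\<bar> \<le> k" "\<bar>n\<bar> \<le> k"
      unfolding k_def by linarith+
    thus "\<omega> \<in> (\<lambda>(m,n). of_int m * \<omega>1 + of_int n * \<omega>2) ` ({-k..k} \<times> {-k..k})"
      using \<omega> by (intro image_eqI[of _ _ "(m, n)"]) auto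
  qed
  thus ?thesis
    by (rule finite_subset) auto
qed

lemma weierstrass_zeta_meromorphic:
  assumes "is_lattice \<Lambda>"
  shows "weierstrass_zeta \<Lambda> meromorphic_on UNIV"
proof -
  define f :: "complex \<Rightarrow> complex \<Rightarrow> complex"
    where "f = (\<lambda>\<omega> z. 1 / (z - \<omega>) + 1 / \<omega> + z / \<omega>\<^sup>2)"
  have "weierstrass_zeta \<Lambda> meromorphic_on ball 0 R" if R: "R > 0" for R
  proof -
    define F where "F = {\<omega>\<in>\<Lambda> - {0}. norm \<omega> \<le> 2 * R}"
    define G where "G = {\<omega>\<in>\<Lambda> - {0}. norm \<omega> > 2 * R}"
    have [intro]: "finite F"
      by (rule finite_subset[OF _ finite_lattice_cball[OF assms, of "2 * R"]]) (auto simp: F_def)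
    have FG: "\<Lambda> - {0} = F \<union> G" "F \<inter> G = {}"
      by (auto simp: F_def G_def)
    have M: "(\<lambda>\<omega>. 2 * R\<^sup>2 * (1 / norm \<omega> ^ 3)) summable_on G"
      by (intro summable_on_cmult_right summable_on_subset_banach[OF lattice_summable[OF assms]])
         (auto simp: G_def)
    have bound: "norm (f \<omega> z) \<le> 2 * R\<^sup>2 * (1 / norm \<omega> ^ 3)" if "\<omega> \<in> G" "z \<in> cball 0 R" for \<omega> z
    proof -
      have \<omega>: "norm \<omega> > 2 * R" "norm z \<le> R" "\<omega> \<noteq> 0"
        using that by (auto simp: G_def)
      have "norm (z - \<omega>) \<ge> norm \<omega> - norm z"
        by (metis norm_minus_commute norm_triangle_ineq2)
      hence half: "norm (z - \<omega>) \<ge> norm \<omega> / 2"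
        using \<omega> by linarith
      have "norm (z - \<omega>) > 0"
        using half zero_less_norm_iff[of \<omega>] \<omega>(3) by linarith
      hence "z - \<omega> \<noteq> 0" by simp
      hence "f \<omega> z = z\<^sup>2 / (\<omega>\<^sup>2 * (z - \<omega>))"
        using \<omega>(3) by (simp add: f_def divide_simps) (simp add: power2_eq_square algebra_simps)
      hence "norm (f \<omega> z) = norm z ^ 2 / (norm \<omega> ^ 2 * norm (z - \<omega>))"
        by (simp add: norm_divide norm_mult norm_power)
      also have "\<dots> \<le> R\<^sup>2 / (norm \<omega> ^ 2 * (norm \<omega> / 2))"
        using \<omega> half \<open>norm (z - \<omega>) > 0\<close> by (intro frac_le mult_left_mono power_mono) auto
      also have "\<dots> = 2 * R\<^sup>2 * (1 / norm \<omega> ^ 3)"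
        by (simp add: power2_eq_square power3_eq_cube)
      finally show ?thesis .
    qed
    have lim: "uniform_limit (cball 0 R) (\<lambda>X z. \<Sum>\<omega>\<in>X. f \<omega> z) (\<lambda>z. \<Sum>\<^sub>\<infinity>\<omega>\<in>G. f \<omega> z)
                 (finite_subsets_at_top G)"
      using bound M by (rule Weierstrass_m_test_general)
    have nz: "z - \<omega> \<noteq> 0" if "z \<in> cball 0 R" "\<omega> \<in> G" for z \<omega>
      using that R by (auto simp: G_def)
    have hol: "(\<lambda>z. \<Sum>\<omega>\<in>X. f \<omega> z) holomorphic_on cball 0 R" if "X \<subseteq> G" for X
      unfolding f_def using nz that by (intro holomorphic_intros) (auto simp: G_def)
    have G_hol: "(\<lambda>z. \<Sum>\<^sub>\<infinity>\<omega>\<in>G. f \<omega> z) holomorphic_on ball 0 R"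
    proof (rule holomorphic_uniform_limit[OF _ lim])
      show "\<forall>\<^sub>F X in finite_subsets_at_top G. continuous_on (cball 0 R) (\<lambda>z. \<Sum>\<omega>\<in>X. f \<omega> z) \<and>
              (\<lambda>z. \<Sum>\<omega>\<in>X. f \<omega> z) holomorphic_on ball 0 R"
        using hol by (intro eventually_finite_subsets_at_top_weakI)
          (meson ball_subset_cball holomorphic_on_imp_continuous_on holomorphic_on_subset)
    qed auto
    have M': "(\<lambda>\<omega>. norm (2 * R\<^sup>2 * (1 / norm \<omega> ^ 3))) summable_on G"
      using M by (simp add: norm_mult norm_power)
    have summ: "(\<lambda>\<omega>. f \<omega> z) summable_on G" if "z \<in> ball 0 R" for z
    proof (rule abs_summable_summable, rule Infinite_Sum.abs_summable_on_comparison_test[OF M'])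
      fix \<omega> assume "\<omega> \<in> G"
      thus "norm (f \<omega> z) \<le> norm (2 * R\<^sup>2 * (1 / norm \<omega> ^ 3))"
        using bound[of \<omega> z] that by (auto intro: order.trans[OF _ abs_ge_self])
    qed
    have eq: "weierstrass_zeta \<Lambda> z = 1 / z + ((\<Sum>\<omega>\<in>F. f \<omega> z) + (\<Sum>\<^sub>\<infinity>\<omega>\<in>G. f \<omega> z))"
      if "z \<in> ball 0 R" for z
      unfolding weierstrass_zeta_def FG(1)
      using summ[OF that] FG(2) \<open>finite F\<close>
      by (subst infsum_Un_disjoint) (auto simp: f_def)
    have "(\<lambda>z. 1 / z + ((\<Sum>\<omega>\<in>F. f \<omega> z) + (\<Sum>\<^sub>\<infinity>\<omega>\<in>G. f \<omega> z))) meromorphic_on ball 0 R"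
      unfolding f_def
      by (intro meromorphic_intros analytic_on_imp_meromorphic_on
            G_hol[unfolded f_def, THEN analytic_on_open[OF open_ball, THEN iffD2]])
    also have "?this \<longleftrightarrow> ?thesis"
    proof (rule meromorphic_on_cong)
      fix z :: complex assume z: "z \<in> ball 0 R"
      have "\<forall>\<^sub>F w in at z. w \<in> ball 0 R"
        using z by (intro eventually_at_in_open') auto
      thus "\<forall>\<^sub>F w in at z. 1 / w + ((\<Sum>\<omega>\<in>F. f \<omega> w) + (\<Sum>\<^sub>\<infinity>\<omega>\<in>G. f \<omega> w)) = weierstrass_zeta \<Lambda> w"
        by eventually_elim (simp add: eq)
    qed auto
    finally show ?thesis .
  qed
  hence "weierstrass_zeta \<Lambda> meromorphic_on (\<Union>n. ball 0 (real (Suc n)))"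
    by (subst meromorphic_on_UN) auto
  also have "(\<Union>n. ball 0 (real (Suc n))) = (UNIV :: complex set)"
  proof -
    have "\<exists>n. norm z < real (Suc n)" for z :: complex
      using reals_Archimedean2[of "norm z"] by (meson less_trans lessI of_nat_less_iff)
    thus ?thesis by auto
  qed
  finally show ?thesis .
qed

definition mero_zeta :: "complex set \<Rightarrow> mero" where
  "mero_zeta \<Lambda> = abs_mero (weierstrass_zeta \<Lambda>)"

text \<open>
  This is meaningful for lattices, by \<open>weierstrass_zeta_meromorphic\<close>. At the lattice points, which
  are the poles, \<open>weierstrass_zeta\<close> has an irrelevant value because of \<open>1 / 0 = 0\<close>.
\<close>


section \<open>Matrices and ring adjunction\<close>

definition gl :: "'a set \<Rightarrow> ('a ^ 'n ^ 'n) set" where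
  "gl R = {A. \<forall>i j. A $ i $ j \<in> R}"

definition GL :: "'a::field set \<Rightarrow> ('a ^ 'n ^ 'n) set" where
  "GL R = {A \<in> gl R. \<exists>A'\<in>gl R. A ** A' = mat 1 \<and> A' ** A = mat 1}"

definition is_subring :: "'a::comm_ring_1 set \<Rightarrow> bool" where
  "is_subring R \<longleftrightarrow> 1 \<in> R \<and> (\<forall>x\<in>R. \<forall>y\<in>R. x - y \<in> R \<and> x * y \<in> R)"

text \<open>
  For a subring \<open>R\<close>, \<open>ring_adjoin R X\<close> is $R[X]$, the smallest subring containing \<open>R\<close> and \<open>X\<close>.
\<close>

definition ring_adjoin :: "'a::comm_ring_1 set \<Rightarrow> 'a set \<Rightarrow> 'a set" where
  "ring_adjoin R X = is_subring hull (R \<union> X)"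

end

theory Submission
  imports Defs "HOL-Computational_Algebra.Fundamental_Theorem_Algebra"
begin

text \<open>
  The relation makes $U(qz)$ and $A(z) U(z)$ solutions of the same linear system, so
  $U(qz) = A(z) U(z) C$ with $C$ constant. For $\omega \in \Lambda$ also $U(z + \omega) = U(z) M$ with
  $M$ constant, so some polynomial in the translation by $\omega$ kills all entries of $U$. Applying
  the dilation shows that with $p(x)$ also $p(x^q)$ kills them, so the roots of a generator of
  the annihilator are stable under $q$-th powers and are therefore roots of unity: some translation
  by $N \omega$ acts unipotently. After replacing $\Lambda$ by a sublattice, both basis translations
  act unipotently. Combinations $x, y$ of $z$ and $\zeta$ on which they act as
  $(x + 1, y)$ and $(x, y + 1)$ exist because the periods and quasi-periods are not
  proportional, and Newton's difference formula in $x$ and then in $y$ expresses the entries as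
  polynomials in $x, y$ with elliptic coefficients.

  Were the quasi-periods proportional to the periods, some $f = \zeta - cz$ would be elliptic with
  simple poles of residue 1 at the lattice points only; by Liouville's theorem
  $f' + f^2 - 2hf$ is constant for a suitable $h$, and the solutions of this Riccati equation are
  not doubly periodic.
\<close>

section \<open>Arithmetic, translation, dilation and derivation on $M$\<close>

text \<open>A system with elliptic coefficients may have solutions that involve exponentials, on
  which a translation acts with arbitrary eigenvalues; the relation with the dilation is what
  excludes them. Write phi for the dilation and T_w for the translation by w, so that phi T_{qw} =
  T_w phi. The entries of phi(U) = A U C are combinations of the entries of U with
  \<Lambda>-periodic coefficients. Hence a p(T_w) that kills all entries of U kills those of phi(U),
  and p(T_{qw}) = p((T_w)^q) kills the entries of U.

  Passing from \<omega> to N \<omega> turns the roots of unity into 1 but shrinks the lattice. This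
  is why the coefficients are sought in the union K over the commensurability class and not in a
  single field of elliptic functions. The two generators are treated separately, through
  annihilating polynomials, instead of bringing two commuting matrices to a common normal form;
  Newton's formula then does the work of the nilpotent parts.\<close>

lemma mero_cases:
  obtains f where "mero_rel f f" "F = abs_mero f"
  using Quotient_abs_rep[OF Quotient_mero] Quotient_rep_reflp[OF Quotient_mero] by metis

lemma abs_mero_eq_iff:
  "mero_rel f f \<Longrightarrow> mero_rel g g \<Longrightarrow> abs_mero f = abs_mero g \<longleftrightarrow> mero_rel f g"
  using Quotient_rel[OF Quotient_mero] by blast

lemma mero_const_add: "mero_const (a + b) = mero_const a + mero_const b"
  by transfer (auto simp: mero_rel_def)

lemma mero_const_mult: "mero_const (a * b) = mero_const a * mero_const b"
  by transfer (auto simp: mero_rel_def)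

lemma mero_const_minus: "mero_const (- a) = - mero_const a"
  by transfer (auto simp: mero_rel_def)

lemma mero_const_diff: "mero_const (a - b) = mero_const a - mero_const b"
  by transfer (auto simp: mero_rel_def)

lemma mero_const_inverse: "mero_const (inverse a) = inverse (mero_const a)"
  by transfer (auto simp: mero_rel_def)

lemma mero_const_0 [simp]: "mero_const 0 = 0"
  by transfer (auto simp: mero_rel_def)

lemma mero_const_1 [simp]: "mero_const 1 = 1"
  by transfer (auto simp: mero_rel_def)

lemma mero_const_sum: "mero_const (sum f A) = (\<Sum>x\<in>A. mero_const (f x))"
  by (induction A rule: infinite_finite_induct) (auto simp: mero_const_add)

lemma mero_const_of_nat: "mero_const (of_nat n) = of_nat n"
  by (induction n) (auto simp: mero_const_add)

lemma mero_const_of_int: "mero_const (of_int n) = of_int n"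
  by (cases n) (auto simp: mero_const_of_nat mero_const_add mero_const_minus mero_const_diff)

lemma mero_const_eq_iff [simp]: "mero_const a = mero_const b \<longleftrightarrow> a = b"
  by transfer (auto simp: mero_rel_def)

lemma mero_const_eq_0_iff [simp]: "mero_const a = 0 \<longleftrightarrow> a = 0"
  using mero_const_eq_iff[of a 0] by (simp del: mero_const_eq_iff)

text \<open>This makes the binomial coefficients \<open>x gchoose k\<close> available for
  \<open>x\<close> in $M$.\<close>

instance mero :: field_char_0
proof
  show "inj (of_nat :: nat \<Rightarrow> mero)"
    by (rule injI) (metis mero_const_eq_iff mero_const_of_nat of_nat_eq_iff)
qed

lemma mero_rel_shift_meromorphic:
  "mero_rel f f \<Longrightarrow> (\<lambda>z. f (z + a)) meromorphic_on UNIV"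
  using mero_relD(1)[OF mero_rel_affine[of f f 1 a]] by simp

lemma mero_rel_dilate_meromorphic:
  "mero_rel f f \<Longrightarrow> c \<noteq> 0 \<Longrightarrow> (\<lambda>z. f (c * z)) meromorphic_on UNIV"
  using mero_relD(1)[OF mero_rel_affine[of f f c 0]] by simp

lemma mero_shift_add: "mero_shift a (f + g) = mero_shift a f + mero_shift a g"
proof transfer
  fix a and f g :: "complex \<Rightarrow> complex" assume fg: "mero_rel f f" "mero_rel g g"
  show "mero_rel (\<lambda>z. f (z + a) + g (z + a)) (\<lambda>z. f (z + a) + g (z + a))"
    using fg[THEN mero_rel_shift_meromorphic, of a] by (simp add: mero_rel_refl_iff meromorphic_intros)
qed

lemma mero_shift_mult: "mero_shift a (f * g) = mero_shift a f * mero_shift a g"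
proof transfer
  fix a and f g :: "complex \<Rightarrow> complex" assume fg: "mero_rel f f" "mero_rel g g"
  show "mero_rel (\<lambda>z. f (z + a) * g (z + a)) (\<lambda>z. f (z + a) * g (z + a))"
    using fg[THEN mero_rel_shift_meromorphic, of a] by (simp add: mero_rel_refl_iff meromorphic_intros)
qed

lemma mero_shift_const [simp]: "mero_shift a (mero_const c) = mero_const c"
  by transfer (auto simp: mero_rel_def)

lemma mero_shift_id: "mero_shift a mero_id = mero_id + mero_const a"
  by transfer (auto simp: mero_rel_def intro!: meromorphic_intros)

lemma mero_shift_0_left [simp]: "mero_shift 0 f = f"
  by transfer (auto simp: mero_rel_def)

lemma mero_shift_shift: "mero_shift a (mero_shift b f) = mero_shift (a + b) f"
proof transfer
  fix a b and f :: "complex \<Rightarrow> complex" assume "mero_rel f f"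
  thus "mero_rel (\<lambda>z. f (z + a + b)) (\<lambda>z. f (z + (a + b)))"
    using mero_rel_affine[of f f 1 "a + b"] by (simp add: add.assoc)
qed

lemma mero_shift_0 [simp]: "mero_shift a 0 = 0"
  using mero_shift_const[of a 0] by simp

lemma mero_shift_1 [simp]: "mero_shift a 1 = 1"
  using mero_shift_const[of a 1] by simp

lemma mero_shift_minus: "mero_shift a (- f) = - mero_shift a f"
  by (metis add_eq_0_iff mero_shift_0 mero_shift_add)

lemma mero_shift_diff: "mero_shift a (f - g) = mero_shift a f - mero_shift a g"
  using mero_shift_add[of a f "- g"] by (simp add: mero_shift_minus)

lemma mero_shift_eq_iff [simp]: "mero_shift a f = mero_shift a g \<longleftrightarrow> f = g"
  by (metis add.left_inverse mero_shift_0_left mero_shift_shift)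

lemma mero_shift_eq_0_iff [simp]: "mero_shift a f = 0 \<longleftrightarrow> f = 0"
  using mero_shift_eq_iff[of a f 0] by (simp del: mero_shift_eq_iff)

lemma mero_shift_inverse: "mero_shift a (inverse f) = inverse (mero_shift a f)"
proof (cases "f = 0")
  case False
  have "mero_shift a f * mero_shift a (inverse f) = 1"
    using False by (simp flip: mero_shift_mult)
  thus ?thesis
    by (metis inverse_unique)
qed auto

lemma mero_shift_divide: "mero_shift a (f / g) = mero_shift a f / mero_shift a g"
  by (simp add: divide_inverse mero_shift_mult mero_shift_inverse)

lemma mero_shift_sum: "mero_shift a (sum f A) = (\<Sum>x\<in>A. mero_shift a (f x))"
  by (induction A rule: infinite_finite_induct) (auto simp: mero_shift_add)

lemma mero_dilate_add:
  "mero_dilate c (f + g) = mero_dilate c f + mero_dilate c g"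
proof transfer
  fix c and f g :: "complex \<Rightarrow> complex" assume fg: "mero_rel f f" "mero_rel g g"
  show "mero_rel (\<lambda>z. if c = 0 then 0 else f (c * z) + g (c * z))
          (\<lambda>z. (if c = 0 then 0 else f (c * z)) + (if c = 0 then 0 else g (c * z)))"
    using fg[THEN mero_rel_dilate_meromorphic, of c]
    by (cases "c = 0") (simp_all add: mero_rel_refl_iff meromorphic_intros)
qed

lemma mero_dilate_mult:
  "mero_dilate c (f * g) = mero_dilate c f * mero_dilate c g"
proof transfer
  fix c and f g :: "complex \<Rightarrow> complex" assume fg: "mero_rel f f" "mero_rel g g"
  show "mero_rel (\<lambda>z. if c = 0 then 0 else f (c * z) * g (c * z))
          (\<lambda>z. (if c = 0 then 0 else f (c * z)) * (if c = 0 then 0 else g (c * z)))"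
    using fg[THEN mero_rel_dilate_meromorphic, of c]
    by (cases "c = 0") (simp_all add: mero_rel_refl_iff meromorphic_intros)
qed

lemma mero_dilate_const: "c \<noteq> 0 \<Longrightarrow> mero_dilate c (mero_const a) = mero_const a"
  by transfer (auto simp: mero_rel_def)

lemma mero_dilate_0 [simp]: "mero_dilate c 0 = 0"
  by transfer (auto simp: mero_rel_def)

lemma mero_dilate_sum: "mero_dilate c (sum f A) = (\<Sum>x\<in>A. mero_dilate c (f x))"
  by (induction A rule: infinite_finite_induct) (auto simp: mero_dilate_add)

text \<open>The origin of the q-th powers: a translation by \<open>a\<close> after the dilation is
  one by \<open>c * a\<close> before it. For \<open>c = 0\<close> both sides are the dummy value
  0.\<close>

lemma mero_dilate_shift:
  "mero_dilate c (mero_shift (c * a) f) = mero_shift a (mero_dilate c f)"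
proof transfer
  fix c a and f :: "complex \<Rightarrow> complex" assume f: "mero_rel f f"
  show "mero_rel (\<lambda>z. if c = 0 then 0 else f (c * z + c * a))
          (\<lambda>z. if c = 0 then 0 else f (c * (z + a)))"
    using mero_rel_affine[OF f, of c "c * a"]
    by (cases "c = 0") (simp_all add: ring_distribs mero_rel_refl_iff meromorphic_intros)
qed

lemma mero_dilate_dilate:
  "c \<noteq> 0 \<Longrightarrow> d \<noteq> 0 \<Longrightarrow> mero_dilate c (mero_dilate d f) = mero_dilate (d * c) f"
proof transfer
  fix c d :: complex and f :: "complex \<Rightarrow> complex" assume "mero_rel f f" and cd: "c \<noteq> 0" "d \<noteq> 0"
  hence "mero_rel (\<lambda>z. f (d * c * z)) (\<lambda>z. f (d * c * z))"
    using mero_rel_affine[of f f "d * c" 0] by simp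
  thus "mero_rel (\<lambda>z. if c = 0 then 0 else if d = 0 then 0 else f (d * (c * z)))
          (\<lambda>z. if d * c = 0 then 0 else f (d * c * z))"
    using cd by (simp add: mult.assoc)
qed

lemma mero_dilate_1 [simp]: "mero_dilate 1 f = f"
  by transfer auto

lemma mero_dilate_eq_0_iff: "c \<noteq> 0 \<Longrightarrow> mero_dilate c f = 0 \<longleftrightarrow> f = 0"
  using mero_dilate_dilate[of "inverse c" c f] by auto

text \<open>A derivative depends on a full neighbourhood, whereas representatives of an element of
  $M$ agree only off a discrete set. A punctured neighbourhood can be taken open, so an identity
  valid there is valid around each of its points.\<close>

lemma eventually_at_imp_eventually_nhds:
  assumes "\<forall>\<^sub>F w in at z. P w"
  shows "\<forall>\<^sub>F w in at z. \<forall>\<^sub>F u in nhds w. P (u :: complex)"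
proof -
  obtain S where S: "open S" "z \<in> S" "\<And>w. w \<in> S \<Longrightarrow> w \<noteq> z \<Longrightarrow> P w"
    using assms by (auto simp: eventually_at_topological)
  have "\<forall>\<^sub>F w in at z. w \<in> S - {z}"
    using S by (intro eventually_at_in_open) auto
  thus ?thesis
  proof eventually_elim
    case (elim w)
    show ?case
      using S elim by (intro eventually_nhds_in_open[of "S - {z}", THEN eventually_mono]) auto
  qed
qed

lemma eventually_cosparse_imp_nhds:
  assumes "\<forall>\<^sub>\<approx>z\<in>UNIV. P z"
  shows "\<forall>\<^sub>\<approx>z\<in>UNIV. \<forall>\<^sub>F w in nhds z. P (w::complex)"
  using assms eventually_at_imp_eventually_nhds by (simp add: eventually_cosparse_open_eq)

lemma cosparse_analytic:
  assumes "mero_rel f f"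
  shows "\<forall>\<^sub>\<approx>z\<in>UNIV. f analytic_on {z}"
  using assms by (auto simp: mero_rel_def intro: meromorphic_on_imp_analytic_cosparse)

lemma mero_deriv_add: "mero_deriv (f + g) = mero_deriv f + mero_deriv g"
proof transfer
  fix f g :: "complex \<Rightarrow> complex" assume fg: "mero_rel f f" "mero_rel g g"
  have "\<forall>\<^sub>\<approx>z\<in>UNIV. deriv (\<lambda>z. f z + g z) z = deriv f z + deriv g z"
    using cosparse_analytic[OF fg(1)] cosparse_analytic[OF fg(2)]
    by eventually_elim (auto intro!: deriv_add analytic_on_imp_differentiable_at)
  thus "mero_rel (deriv (\<lambda>z. f z + g z)) (\<lambda>z. deriv f z + deriv g z)"
    using fg by (auto simp: mero_rel_def intro!: meromorphic_intros)
qed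

lemma mero_deriv_mult: "mero_deriv (f * g) = f * mero_deriv g + mero_deriv f * g"
proof transfer
  fix f g :: "complex \<Rightarrow> complex" assume fg: "mero_rel f f" "mero_rel g g"
  have "\<forall>\<^sub>\<approx>z\<in>UNIV. deriv (\<lambda>z. f z * g z) z = f z * deriv g z + deriv f z * g z"
    using cosparse_analytic[OF fg(1)] cosparse_analytic[OF fg(2)]
    by eventually_elim (auto intro!: deriv_mult analytic_on_imp_differentiable_at)
  thus "mero_rel (deriv (\<lambda>z. f z * g z)) (\<lambda>z. f z * deriv g z + deriv f z * g z)"
    using fg by (auto simp: mero_rel_def intro!: meromorphic_intros)
qed

lemma mero_deriv_const [simp]: "mero_deriv (mero_const c) = 0"
  by transfer (auto simp: mero_rel_def)

lemma mero_deriv_0 [simp]: "mero_deriv 0 = 0"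
  using mero_deriv_const[of 0] by simp

lemma mero_deriv_id [simp]: "mero_deriv mero_id = 1"
  by transfer (auto simp: mero_rel_def)

lemma mero_deriv_sum: "mero_deriv (sum f A) = (\<Sum>x\<in>A. mero_deriv (f x))"
  by (induction A rule: infinite_finite_induct) (auto simp: mero_deriv_add)

lemma mero_deriv_minus: "mero_deriv (- f) = - mero_deriv f"
  using mero_deriv_add[of f "- f"] by (simp add: add_eq_0_iff2)

lemma mero_deriv_diff: "mero_deriv (f - g) = mero_deriv f - mero_deriv g"
  using mero_deriv_add[of f "- g"] by (simp add: mero_deriv_minus)

lemma mero_deriv_inverse:
  assumes "f \<noteq> 0"
  shows "mero_deriv (inverse f) = - mero_deriv f / f ^ 2"
proof -
  have "mero_deriv (f * inverse f) = 0"
    using assms mero_deriv_const[of 1] by simp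
  hence "f * mero_deriv (inverse f) = - (mero_deriv f * inverse f)"
    by (simp add: mero_deriv_mult add_eq_0_iff)
  hence "mero_deriv (inverse f) = - (mero_deriv f * inverse f) / f"
    using assms by (simp add: field_simps)
  thus ?thesis
    by (simp add: divide_inverse power2_eq_square mult.assoc)
qed

lemma deriv_affine:
  assumes "f analytic_on {c * z + a}"
  shows "deriv (\<lambda>z. f (c * z + a)) z = c * deriv f (c * z + a)"
proof (rule DERIV_imp_deriv)
  have "(f has_field_derivative deriv f (c * z + a)) (at (c * z + a))"
    using assms by (intro analytic_derivI)
  moreover have "((\<lambda>z. c * z + a) has_field_derivative c) (at z)"
    by (auto intro!: derivative_eq_intros)
  ultimately have "(f \<circ> (\<lambda>z. c * z + a) has_field_derivative deriv f (c * z + a) * c) (at z)"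
    by (rule DERIV_chain)
  thus "((\<lambda>z. f (c * z + a)) has_field_derivative c * deriv f (c * z + a)) (at z)"
    by (simp add: o_def mult.commute)
qed

lemma mero_rel_deriv_affine:
  assumes "mero_rel f f" "c \<noteq> 0"
  shows "mero_rel (deriv (\<lambda>z. f (c * z + a))) (\<lambda>z. c * deriv f (c * z + a))"
proof -
  have d: "mero_rel (deriv f) (deriv f)"
    using assms(1) by (auto simp: mero_rel_def intro!: meromorphic_intros)
  have an: "\<forall>\<^sub>F w in at (c * z + a). f analytic_on {w}" for z
    using cosparse_analytic[OF assms(1)] by (simp add: eventually_cosparse_open_eq)
  have "filterlim (\<lambda>w. c * w + a) (at (c * z + a)) (at z)" for z
    using assms(2)
    by (intro filterlim_atI tendsto_intros) (auto simp: eventually_at_filter)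
  hence an': "\<forall>\<^sub>F w in at z. f analytic_on {c * w + a}" for z
    using an eventually_compose_filterlim by blast
  have "\<forall>\<^sub>F w in at z. deriv (\<lambda>z. f (c * z + a)) w = c * deriv f (c * w + a)" for z
    using an'[of z] by eventually_elim (rule deriv_affine)
  hence "\<forall>\<^sub>\<approx>z\<in>UNIV. deriv (\<lambda>z. f (c * z + a)) z = c * deriv f (c * z + a)"
    by (simp add: eventually_cosparse_open_eq)
  thus ?thesis
    using mero_rel_affine[OF assms, of a] mero_rel_affine[OF d assms(2), of a]
    by (auto simp: mero_rel_def intro!: meromorphic_intros)
qed

lemma mero_deriv_shift: "mero_deriv (mero_shift a f) = mero_shift a (mero_deriv f)"
proof transfer
  fix a and f :: "complex \<Rightarrow> complex" assume "mero_rel f f"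
  from mero_rel_deriv_affine[OF this, of 1 a]
  show "mero_rel (deriv (\<lambda>z. f (z + a))) (\<lambda>z. deriv f (z + a))"
    by simp
qed

lemma mero_deriv_dilate:
  "mero_deriv (mero_dilate c f) = mero_const c * mero_dilate c (mero_deriv f)"
proof transfer
  fix c and f :: "complex \<Rightarrow> complex" assume "mero_rel f f"
  from mero_rel_deriv_affine[OF this, of c 0]
  show "mero_rel (deriv (\<lambda>z. if c = 0 then 0 else f (c * z)))
          (\<lambda>z. c * (if c = 0 then 0 else deriv f (c * z)))"
    by (cases "c = 0") (auto simp: mero_rel_def)
qed

text \<open>The vanishing derivative gives constancy only on a ball of analyticity. Off a closed
  discrete set, a meromorphic function either equals a given value or avoids it, so this one ball
  decides.\<close>

lemma mero_deriv_eq_0_imp_const: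
  assumes "mero_deriv F = 0"
  shows "\<exists>c. F = mero_const c"
proof -
  obtain f where f: "mero_rel f f" "F = abs_mero f"
    by (rule mero_cases)
  have "mero_rel (deriv f) (\<lambda>_. 0)"
    using assms f unfolding f(2) mero_deriv.abs_eq[OF f(1)] zero_mero.abs_eq
    by (subst (asm) abs_mero_eq_iff) (auto simp: mero_rel_def intro!: meromorphic_intros)
  hence "\<forall>\<^sub>\<approx>z\<in>UNIV. deriv f z = 0"
    by (auto simp: mero_rel_def)
  hence "\<forall>\<^sub>\<approx>z\<in>UNIV. \<forall>\<^sub>F w in nhds z. f analytic_on {w} \<and> deriv f w = 0"
    using cosparse_analytic[OF f(1)]
    by (intro eventually_cosparse_imp_nhds eventually_conj)
  then obtain z where "\<forall>\<^sub>F w in nhds z. f analytic_on {w} \<and> deriv f w = 0"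
    using eventually_happens[of _ "cosparse (UNIV :: complex set)"] by auto
  then obtain r where r: "r > 0" "\<And>w. w \<in> ball z r \<Longrightarrow> f analytic_on {w} \<and> deriv f w = 0"
    by (auto simp: eventually_nhds_metric dist_commute)
  have "\<exists>c. \<forall>w\<in>ball z r. f w = c"
  proof (rule has_field_derivative_zero_constant)
    show "(f has_field_derivative 0) (at u within ball z r)" if "u \<in> ball z r" for u
      using r(2)[OF that] analytic_derivI[of f u]
      by (auto intro: has_field_derivative_at_within)
  qed auto
  hence eq: "f w = f z" if "w \<in> ball z r" for w
    using that r(1) by force
  have "\<not> (\<forall>\<^sub>\<approx>w\<in>UNIV. f w \<noteq> f z)"
  proof
    assume "\<forall>\<^sub>\<approx>w\<in>UNIV. f w \<noteq> f z"
    hence "\<forall>\<^sub>F w in at z. f w \<noteq> f z"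
      by (simp add: eventually_cosparse_open_eq)
    moreover have "\<forall>\<^sub>F w in at z. w \<in> ball z r"
      using r by (intro eventually_at_in_open') auto
    ultimately have "\<forall>\<^sub>F w in at z. False"
      by eventually_elim (use eq in auto)
    thus False by simp
  qed
  hence "\<forall>\<^sub>\<approx>w\<in>UNIV. f w = f z"
    using meromorphic_imp_constant_or_avoid[of f UNIV "f z"] f
    by (auto simp: mero_rel_def)
  hence "mero_rel f (\<lambda>_. f z)"
    using f by (auto simp: mero_rel_def)
  thus ?thesis
    unfolding f(2) mero_const.abs_eq
    by (intro exI[of _ "f z"] abs_mero_eq_iff[THEN iffD2]) (use f(1) in \<open>auto simp: mero_rel_refl_iff\<close>)
qed


section \<open>Quasi-unipotence of the translations\<close>

lemma map_matrix_mult: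
  fixes A B :: "'a::semiring_1 ^ 'n ^ 'n"
  assumes "\<And>x y. h (x * y) = h x * h y" "\<And>(f :: 'n \<Rightarrow> 'a) A. h (sum f A) = (\<Sum>x\<in>A. h (f x))"
  shows "map_matrix h (A ** B) = map_matrix h A ** (map_matrix h B :: 'b::semiring_1 ^ 'n ^ 'n)"
  by (simp add: vec_eq_iff map_matrix_def matrix_matrix_mult_def assms)

lemma map_matrix_deriv_mult:
  fixes A B :: "mero ^ 'n ^ 'n"
  shows "map_matrix mero_deriv (A ** B) = A ** map_matrix mero_deriv B + map_matrix mero_deriv A ** B"
  by (simp add: vec_eq_iff map_matrix_def matrix_matrix_mult_def mero_deriv_sum mero_deriv_mult sum.distrib)

text \<open>Here \<open>U'\<close> is the inverse of \<open>U\<close>, not a derivative.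
  Differentiating V = U D and comparing with the equation for \<open>V\<close> shows that
  \<open>U\<close> times the derivative of D is 0, so D is constant.\<close>

lemma linear_ode_solutions_differ_by_const:
  fixes G U V :: "mero ^ 'n ^ 'n"
  assumes "U ** U' = mat 1" "U' ** U = mat 1"
    and U: "map_matrix mero_deriv U = G ** U" and V: "map_matrix mero_deriv V = G ** V"
  obtains C where "V = U ** map_matrix mero_const C"
proof -
  define D where "D = U' ** V"
  have VD: "V = U ** D"
    by (simp add: D_def matrix_mul_assoc assms)
  have "map_matrix mero_deriv V = U ** map_matrix mero_deriv D + G ** V"
    by (subst (1) VD) (simp add: map_matrix_deriv_mult U VD matrix_mul_assoc)
  hence "U ** map_matrix mero_deriv D = 0"
    using V by simp
  hence "U' ** (U ** map_matrix mero_deriv D) = 0"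
    by (simp add: matrix_matrix_mult_def vec_eq_iff)
  hence "map_matrix mero_deriv D = 0"
    by (simp add: matrix_mul_assoc assms)
  hence "\<exists>c. D $ i $ j = mero_const c" for i j
    by (intro mero_deriv_eq_0_imp_const) (simp add: vec_eq_iff map_matrix_def)
  then obtain c where "\<And>i j. D $ i $ j = mero_const (c i j)"
    by metis
  hence "D = map_matrix mero_const (\<chi> i j. c i j)"
    by (simp add: vec_eq_iff map_matrix_def)
  with VD show ?thesis using that by blast
qed

text \<open>The action of $\mathbb{C}[x]$ on $M$ in which $x$ acts as $f(z) \mapsto f(z + w)$.\<close>

definition pact :: "complex \<Rightarrow> complex poly \<Rightarrow> mero \<Rightarrow> mero" where
  "pact w p f = (\<Sum>i\<le>degree p. mero_const (coeff p i) * mero_shift (of_nat i * w) f)"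

lemma pact_0_left [simp]: "pact w 0 f = 0"
  by (simp add: pact_def)

lemma pact_pCons: "pact w (pCons a p) f = mero_const a * f + mero_shift w (pact w p f)"
  by (cases "p = 0")
     (simp_all add: pact_def sum.atMost_Suc_shift mero_shift_sum mero_shift_mult mero_shift_shift
        ring_distribs del: sum.atMost_Suc)

lemma pact_add: "pact w (p + q) f = pact w p f + pact w q f"
  by (induction p q rule: poly_induct2)
     (simp_all add: pact_pCons mero_const_add mero_shift_add ring_distribs)

lemma pact_smult: "pact w (smult a p) f = mero_const a * pact w p f"
  by (induction p) (simp_all add: pact_pCons mero_const_mult mero_shift_mult ring_distribs mult.assoc)

lemma pact_diff: "pact w (p - q) f = pact w p f - pact w q f"
  using pact_add[of w "p - q" q f] by simp

lemma pact_mult: "pact w (p * q) f = pact w p (pact w q f)"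
  by (induction p) (simp_all add: pact_pCons pact_add pact_smult)

lemma pact_1 [simp]: "pact w 1 f = f"
  by (simp add: pact_pCons one_pCons)

lemma pact_monom_1: "pact w (monom 1 n) f = mero_shift (of_nat n * w) f"
  by (induction n)
     (simp_all add: pact_pCons monom_Suc monom_0 mero_shift_shift ring_distribs)

lemma pact_pcompose_monom: "pact w (p \<circ>\<^sub>p monom 1 n) f = pact (of_nat n * w) p f"
  by (induction p) (simp_all add: pact_pCons pcompose_pCons pact_add pact_mult pact_monom_1)

lemma pact_0_right [simp]: "pact w p 0 = 0"
  by (simp add: pact_def)

lemma pact_add_right: "pact w p (f + g) = pact w p f + pact w p g"
  by (simp add: pact_def mero_shift_add ring_distribs sum.distrib)

lemma pact_sum_right: "pact w p (sum f A) = (\<Sum>x\<in>A. pact w p (f x))"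
  by (induction A rule: infinite_finite_induct) (auto simp: pact_add_right)

text \<open>Functions of period \<open>w\<close> are scalars for the action; this lets the entries
  of \<open>A\<close> be pulled out.\<close>

lemma pact_mult_periodic:
  assumes "mero_shift w g = g"
  shows "pact w p (g * f) = g * pact w p f"
  by (induction p) (simp_all add: pact_pCons mero_shift_mult assms ring_distribs)

lemma pact_dilate:
  "c \<noteq> 0 \<Longrightarrow> mero_dilate c (pact (c * w) p f) = pact w p (mero_dilate c f)"
  by (induction p)
     (simp_all add: pact_pCons mero_dilate_add mero_dilate_mult mero_dilate_const mero_dilate_shift)

lemma pact_power_shift_minus_1:
  "pact w ((monom 1 n - 1) ^ d) f = ((\<lambda>g. mero_shift (of_nat n * w) g - g) ^^ d) f"
  by (induction d) (simp_all add: pact_mult pact_diff pact_monom_1)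

text \<open>Indexed by position because the powers of a matrix may repeat, and their set may then be
  too small to be dependent; a repetition \<open>P i = P j\<close> is itself a dependence.\<close>

lemma exists_linear_dependence:
  fixes P :: "nat \<Rightarrow> 'a::euclidean_space"
  obtains c :: "nat \<Rightarrow> real" and i where
    "i \<le> DIM('a)" "c i \<noteq> 0" "(\<Sum>i\<le>DIM('a). c i *\<^sub>R P i) = 0"
proof (cases "inj_on P {..DIM('a)}")
  case True
  hence "card (P ` {..DIM('a)}) > DIM('a)"
    by (simp add: card_image)
  hence "dependent (P ` {..DIM('a)})"
    using independent_bound[of "P ` {..DIM('a)}"] by auto
  then obtain u v where uv: "v \<in> P ` {..DIM('a)}" "u v \<noteq> 0" "(\<Sum>v\<in>P ` {..DIM('a)}. u v *\<^sub>R v) = 0"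
    by (subst (asm) real_vector.dependent_finite) auto
  then obtain i where "i \<le> DIM('a)" "v = P i"
    by auto
  moreover have "(\<Sum>i\<le>DIM('a). u (P i) *\<^sub>R P i) = 0"
    using uv(3) by (subst (asm) sum.reindex[OF True]) (simp add: o_def)
  ultimately show ?thesis
    using that[of i "u \<circ> P"] uv(2) by simp
next
  case False
  then obtain i j where ij: "i \<le> DIM('a)" "j \<le> DIM('a)" "i \<noteq> j" "P i = P j"
    by (auto simp: inj_on_def)
  define c :: "nat \<Rightarrow> real" where "c = (\<lambda>k. if k = i then 1 else if k = j then -1 else 0)"
  have "(\<Sum>k\<le>DIM('a). c k *\<^sub>R P k) = (\<Sum>k\<in>{i, j}. c k *\<^sub>R P k)"
    using ij by (intro sum.mono_neutral_right) (auto simp: c_def)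
  also have "\<dots> = 0"
    using ij by (simp add: c_def)
  finally show ?thesis
    using ij that[of i c] by (simp add: c_def)
qed

text \<open>Translating k times multiplies \<open>U\<close> on the right by the k-th power of
  \<open>M\<close>. These powers lie in a space of finite dimension, and a linear relation between
  them is a polynomial that kills every entry.\<close>

lemma annihilator_nonzero:
  fixes U :: "mero ^ 'n ^ 'n"
  assumes U: "map_matrix (mero_shift w) U = U ** map_matrix mero_const M"
  obtains p where "p \<noteq> 0" "\<And>i j. pact w p (U $ i $ j) = 0"
proof -
  \<comment> \<open>\<open>P k\<close> is the k-th power of \<open>M\<close>. Translating
    \<open>U ** P k\<close> replaces \<open>U\<close> by \<open>U ** M\<close>, so the new factor
    enters on the left.\<close>
  define P where "P = (\<lambda>k. ((**) M ^^ k) (mat 1))"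
  have shift_P: "map_matrix (mero_shift (of_nat k * w)) U = U ** map_matrix mero_const (P k)" for k
  proof (induction k)
    case 0
    show ?case
      by (simp add: P_def vec_eq_iff map_matrix_def matrix_matrix_mult_def mat_def if_distrib
            sum.delta cong: if_cong)
  next
    case (Suc k)
    have "map_matrix (mero_shift (of_nat (Suc k) * w)) U =
            map_matrix (mero_shift w) (map_matrix (mero_shift (of_nat k * w)) U)"
      by (simp add: vec_eq_iff map_matrix_def mero_shift_shift ring_distribs)
    also have "\<dots> = map_matrix (mero_shift w) U ** map_matrix mero_const (P k)"
      unfolding Suc by (subst map_matrix_mult[OF mero_shift_mult mero_shift_sum])
         (simp add: map_matrix_def)
    also have "\<dots> = U ** map_matrix mero_const (P (Suc k))"
      unfolding U
      by (simp add: P_def map_matrix_mult[OF mero_const_mult mero_const_sum] matrix_mul_assoc)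
    finally show ?case .
  qed
  \<comment> \<open>The dimension over the reals; the real coefficients of the dependence become
    complex ones in \<open>p\<close>.\<close>
  define m where "m = DIM(complex ^ 'n ^ 'n)"
  obtain c k where c: "k \<le> m" "c k \<noteq> 0" "(\<Sum>i\<le>m. c i *\<^sub>R P i) = 0"
    unfolding m_def by (rule exists_linear_dependence)
  have c': "(\<Sum>i\<le>m. complex_of_real (c i) * P i $ a $ b) = 0" for a b
    using arg_cong[OF c(3), of "\<lambda>A. A $ a $ b"] by (simp flip: scaleR_conv_of_real)
  define p where "p = (\<Sum>i\<le>m. smult (complex_of_real (c i)) (monom 1 i))"
  have "coeff p k = of_real (c k)"
    using c(1) by (simp add: p_def coeff_sum sum.delta if_distrib cong: if_cong)
  hence "p \<noteq> 0"
    using c(2) by auto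
  moreover have "pact w p (U $ a $ b) = 0" for a b
  proof -
    have "pact w p f = (\<Sum>i\<le>m. mero_const (of_real (c i)) * mero_shift (of_nat i * w) f)" for f
      unfolding p_def by (induction m) (simp_all add: pact_add pact_smult pact_monom_1 pact_pCons)
    hence "pact w p (U $ a $ b) =
        (\<Sum>i\<le>m. mero_const (of_real (c i)) * (map_matrix (mero_shift (of_nat i * w)) U $ a $ b))"
      by (simp add: map_matrix_def)
    also have "\<dots> = (\<Sum>i\<le>m. \<Sum>l\<in>UNIV. U $ a $ l * mero_const (of_real (c i) * P i $ l $ b))"
      unfolding shift_P
      by (simp add: map_matrix_def matrix_matrix_mult_def sum_distrib_left mero_const_mult mult_ac)
    also have "\<dots> = (\<Sum>l\<in>UNIV. U $ a $ l * mero_const (\<Sum>i\<le>m. of_real (c i) * P i $ l $ b))"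
      by (subst sum.swap) (simp add: mero_const_sum sum_distrib_left)
    finally show ?thesis
      by (simp add: c')
  qed
  ultimately show ?thesis using that by blast
qed

text \<open>Pigeonhole on the powers x^(q^n): two of them coincide, and cancelling leaves the
  exponent q^j - q^i, which is positive because q is at least 2.\<close>

lemma root_of_unity_of_finite_orbit:
  fixes S :: "complex set"
  assumes "finite S" "\<And>x. x \<in> S \<Longrightarrow> x ^ q \<in> S" "q \<ge> 2" "x \<in> S" "x \<noteq> 0"
  obtains N where "N > 0" "x ^ N = 1"
proof -
  have "x ^ (q ^ n) \<in> S" for n
    by (induction n) (use assms in \<open>auto simp: power_mult power_Suc2 simp del: power_Suc\<close>)
  hence "range (\<lambda>n. x ^ (q ^ n)) \<subseteq> S"
    by auto
  hence "\<not> inj (\<lambda>n. x ^ (q ^ n))"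
    using assms(1) by (meson finite_imageD finite_subset infinite_UNIV_nat)
  then obtain i j where ij: "i < j" "x ^ (q ^ i) = x ^ (q ^ j)"
    unfolding inj_def by (metis linorder_neqE_nat)
  have less: "q ^ i < q ^ j"
    using ij assms(3) by (intro power_strict_increasing) auto
  hence "x ^ (q ^ i) * x ^ (q ^ j - q ^ i) = x ^ (q ^ i)"
    using ij(2) by (subst power_add [symmetric]) simp
  hence "x ^ (q ^ j - q ^ i) = 1"
    using assms(5) by simp
  with less show ?thesis
    using that[of "q ^ j - q ^ i"] by simp
qed

text \<open>
  The roots of a generator of \<open>I\<close> are stable under $q$-th powers and, by \<open>X\<close>, nonzero; being
  finitely many, they are roots of unity.
\<close>

lemma quasi_unipotent_of_power_stable_ideal:
  fixes I :: "complex poly set"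
  assumes diff: "\<And>p r. p \<in> I \<Longrightarrow> r \<in> I \<Longrightarrow> p - r \<in> I"
    and mult: "\<And>p r. r \<in> I \<Longrightarrow> p * r \<in> I"
    and X: "\<And>p. pCons 0 p \<in> I \<Longrightarrow> p \<in> I"
    and power: "\<And>p. p \<in> I \<Longrightarrow> p \<circ>\<^sub>p monom 1 q \<in> I"
    and q: "q \<ge> 2" and ne: "\<exists>p\<in>I. p \<noteq> 0"
  obtains N d where "N > 0" "(monom 1 N - 1) ^ d \<in> I"
proof -
  \<comment> \<open>An element of least degree generates \<open>I\<close>, by division with
    remainder.\<close>
  obtain p where p: "p \<in> I" "p \<noteq> 0" and least: "\<And>r. r \<in> I \<Longrightarrow> r \<noteq> 0 \<Longrightarrow> degree p \<le> degree r"
    using ex_has_least_nat[of "\<lambda>p. p \<in> I \<and> p \<noteq> 0" _ degree] ne by blast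
  have dvd: "p dvd r" if "r \<in> I" for r
  proof -
    have "r mod p = r - (r div p) * p"
      by (simp add: minus_div_mult_eq_mod)
    hence "r mod p \<in> I"
      using that p diff mult by metis
    hence "r mod p = 0"
      using least[of "r mod p"] degree_mod_less[OF p(2), of r] by force
    thus ?thesis by auto
  qed
  define S where "S = {x. poly p x = 0}"
  have fin: "finite S"
    using p(2) by (simp add: S_def poly_roots_finite)
  have power_S: "x ^ q \<in> S" if "x \<in> S" for x
  proof -
    have "poly (p \<circ>\<^sub>p monom 1 q) x = 0"
      using dvd[OF power[OF p(1)]] that by (auto simp: S_def dvd_def)
    thus ?thesis
      by (simp add: S_def poly_pcompose poly_monom)
  qed
  have "0 \<notin> S"
  proof
    assume "0 \<in> S"
    then obtain r where r: "p = pCons 0 r"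
      by (cases p) (auto simp: S_def)
    \<comment> \<open>If 0 were a root, then p = x r with r in \<open>I\<close> of smaller
      degree.\<close>
    with p X[of r] least[of r] show False
      by auto
  qed
  hence "\<exists>N>0. x ^ N = 1" if "x \<in> S" for x
    using root_of_unity_of_finite_orbit[OF fin power_S q that] that by metis
  then obtain N where N: "\<And>x. x \<in> S \<Longrightarrow> N x > 0 \<and> x ^ N x = (1::complex)"
    by metis
  define K where "K = prod N S"
  have "x ^ K = 1" if "x \<in> S" for x
  proof -
    have "N x dvd K"
      using that fin by (simp add: K_def dvd_prodI)
    thus ?thesis
      using N[OF that] by (auto simp: dvd_def power_mult)
  qed
  hence "\<forall>x. poly p x = 0 \<longrightarrow> poly (monom 1 K - 1) x = 0"
    by (auto simp: S_def poly_monom)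
  \<comment> \<open>The roots of \<open>p\<close> are among those of x^K - 1; the exponent
    \<open>degree p\<close> accounts for their multiplicities.\<close>
  hence "p dvd (monom 1 K - 1) ^ degree p"
    using p(2) nullstellensatz_univariate[of p "monom 1 K - 1"] by blast
  hence "(monom 1 K - 1) ^ degree p \<in> I"
    using mult[OF p(1)] by (metis dvd_def mult.commute)
  moreover have "K > 0"
    unfolding K_def using N by (intro prod_pos) auto
  ultimately show ?thesis using that by blast
qed

text \<open>The ideal annihilates all entries together because the dilation mixes them: an entry of
  A U C involves entries of \<open>U\<close> from other rows and columns. The coefficients, entries
  of \<open>A\<close> times constants, have period \<open>w\<close>.\<close>

lemma shift_quasi_unipotent:
  fixes U A :: "mero ^ 'n ^ 'n"
  assumes shift_U: "map_matrix (mero_shift w) U = U ** map_matrix mero_const M"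
    and dil_U: "map_matrix (mero_dilate (of_nat q)) U = A ** U ** map_matrix mero_const C"
    and A: "map_matrix (mero_shift w) A = A" and q: "q \<ge> 2"
  obtains N d where "N > 0" "\<And>i j. ((\<lambda>g. mero_shift (of_nat N * w) g - g) ^^ d) (U $ i $ j) = 0"
proof -
  define I where "I = {p. \<forall>i j. pact w p (U $ i $ j) = 0}"
  have "p \<circ>\<^sub>p monom 1 q \<in> I" if "p \<in> I" for p
  proof -
    have p: "pact w p (U $ i $ j) = 0" for i j
      using that by (auto simp: I_def)
    have A': "mero_shift w (A $ i $ j) = A $ i $ j" for i j
      using arg_cong[OF A, of "\<lambda>A. A $ i $ j"] by (simp add: map_matrix_def)
    have "mero_dilate (of_nat q) (pact (of_nat q * w) p (U $ i $ j)) = 0" for i j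
    proof -
      have "mero_dilate (of_nat q) (pact (of_nat q * w) p (U $ i $ j)) =
              pact w p (map_matrix (mero_dilate (of_nat q)) U $ i $ j)"
        using q by (simp add: pact_dilate map_matrix_def)
      also have "\<dots> = pact w p (\<Sum>k\<in>UNIV. \<Sum>l\<in>UNIV. (A $ i $ l * mero_const (C $ k $ j)) * U $ l $ k)"
        unfolding dil_U
        by (simp add: map_matrix_def matrix_matrix_mult_def sum_distrib_right sum_distrib_left mult_ac)
      also have "\<dots> = 0"
        by (simp add: pact_sum_right pact_mult_periodic mero_shift_mult A' p)
      finally show ?thesis .
    qed
    thus ?thesis
      using q by (simp add: I_def pact_pcompose_monom mero_dilate_eq_0_iff)
  qed
  note power = this
  have ne: "\<exists>p\<in>I. p \<noteq> 0"
    by (rule annihilator_nonzero[OF shift_U]) (auto simp: I_def)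
  have diff: "p - r \<in> I" if "p \<in> I" "r \<in> I" for p r
    using that by (simp add: I_def pact_diff)
  have mult: "p * r \<in> I" if "r \<in> I" for p r
    using that by (simp add: I_def pact_mult)
  \<comment> \<open>The factor x acts as a translation, which is injective.\<close>
  have X: "p \<in> I" if "pCons 0 p \<in> I" for p
    using that by (simp add: I_def pact_pCons)
  obtain N d where "N > 0" "(monom 1 N - 1) ^ d \<in> I"
    by (rule quasi_unipotent_of_power_stable_ideal[OF diff mult X power q ne])
  thus ?thesis
    using that by (auto simp: I_def simp flip: pact_power_shift_minus_1)
qed


section \<open>Quasi-periodicity and local behaviour of the zeta function\<close>

lemma lattice_basis:
  assumes "is_lattice \<Lambda>"
  obtains \<omega>1 \<omega>2 where "\<Lambda> = {of_int m * \<omega>1 + of_int n * \<omega>2 | m n. True}"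
    "\<forall>x y::real. of_real x * \<omega>1 + of_real y * \<omega>2 = 0 \<longrightarrow> x = 0 \<and> y = 0"
    "\<forall>z. \<exists>x y::real. z = of_real x * \<omega>1 + of_real y * \<omega>2"
proof -
  obtain \<omega>1 \<omega>2 where *: "\<omega>1 \<noteq> \<omega>2" "independent {\<omega>1, \<omega>2}"
      "\<Lambda> = {of_int m * \<omega>1 + of_int n * \<omega>2 | m n. True}"
    using assms unfolding is_lattice_def by blast
  show ?thesis
  proof (rule that[OF *(3)])
    show "\<forall>x y::real. of_real x * \<omega>1 + of_real y * \<omega>2 = 0 \<longrightarrow> x = 0 \<and> y = 0"
    proof (intro allI impI)
      fix x y :: real assume "of_real x * \<omega>1 + of_real y * \<omega>2 = 0"
      hence "(\<Sum>v\<in>{\<omega>1, \<omega>2}. (if v = \<omega>1 then x else y) *\<^sub>R v) = 0"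
        using *(1) by (auto simp: scaleR_conv_of_real)
      from real_vector.independentD[OF *(2) _ order.refl this]
      have "(if v = \<omega>1 then x else y) = 0" if "v \<in> {\<omega>1, \<omega>2}" for v
        using that by blast
      from this[of \<omega>1] this[of \<omega>2] show "x = 0 \<and> y = 0"
        using *(1) by auto
    qed
  next
    show "\<forall>z. \<exists>x y::real. z = of_real x * \<omega>1 + of_real y * \<omega>2"
    proof
      fix z :: complex
      have "UNIV \<subseteq> span {\<omega>1, \<omega>2}"
        using *(1,2) by (intro card_ge_dim_independent) (auto simp: dim_UNIV)
      hence "z \<in> span {\<omega>1, \<omega>2}"
        by auto
      then obtain x where "z - x *\<^sub>R \<omega>1 \<in> span {\<omega>2}"
        by (auto simp: real_vector.span_insert)
      then obtain y where "z - x *\<^sub>R \<omega>1 = y *\<^sub>R \<omega>2"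
        by (auto simp: real_vector.span_singleton)
      hence "z = of_real x * \<omega>1 + of_real y * \<omega>2"
        by (simp add: scaleR_conv_of_real algebra_simps)
      thus "\<exists>x y::real. z = of_real x * \<omega>1 + of_real y * \<omega>2"
        by blast
    qed
  qed
qed

lemma lattice_0 [simp]: "is_lattice \<Lambda> \<Longrightarrow> 0 \<in> \<Lambda>"
  unfolding is_lattice_def by (force intro: exI[of _ "0::int"])

lemma lattice_diff: "is_lattice \<Lambda> \<Longrightarrow> x \<in> \<Lambda> \<Longrightarrow> y \<in> \<Lambda> \<Longrightarrow> x - y \<in> \<Lambda>"
proof -
  assume *: "is_lattice \<Lambda>" "x \<in> \<Lambda>" "y \<in> \<Lambda>"
  obtain \<omega>1 \<omega>2 where L: "\<Lambda> = {of_int m * \<omega>1 + of_int n * \<omega>2 | m n. True}"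
    using *(1) unfolding is_lattice_def by blast
  obtain m n m' n' where "x = of_int m * \<omega>1 + of_int n * \<omega>2" "y = of_int m' * \<omega>1 + of_int n' * \<omega>2"
    using * unfolding L by blast
  hence "x - y = of_int (m - m') * \<omega>1 + of_int (n - n') * \<omega>2"
    by (simp add: algebra_simps)
  thus ?thesis unfolding L by blast
qed

lemma lattice_uminus: "is_lattice \<Lambda> \<Longrightarrow> x \<in> \<Lambda> \<Longrightarrow> - x \<in> \<Lambda>"
  using lattice_diff[of \<Lambda> 0 x] by simp

lemma lattice_add: "is_lattice \<Lambda> \<Longrightarrow> x \<in> \<Lambda> \<Longrightarrow> y \<in> \<Lambda> \<Longrightarrow> x + y \<in> \<Lambda>"
  using lattice_diff[of \<Lambda> x "- y"] lattice_uminus[of \<Lambda> y] by simp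

lemma lattice_nonzero:
  assumes "is_lattice \<Lambda>" obtains \<omega> where "\<omega> \<in> \<Lambda>" "\<omega> \<noteq> 0"
proof -
  obtain \<omega>1 \<omega>2 where L: "\<Lambda> = {of_int m * \<omega>1 + of_int n * \<omega>2 | m n. True}"
    "\<forall>x y::real. of_real x * \<omega>1 + of_real y * \<omega>2 = 0 \<longrightarrow> x = 0 \<and> y = 0"
    "\<forall>z. \<exists>x y::real. z = of_real x * \<omega>1 + of_real y * \<omega>2"
    by (rule lattice_basis[OF assms])
  have "of_int 1 * \<omega>1 + of_int 0 * \<omega>2 \<in> \<Lambda>"
    unfolding L(1) by blast
  hence "\<omega>1 \<in> \<Lambda>"
    by simp
  moreover have "\<omega>1 \<noteq> 0"
    using L(2)[rule_format, of 1 0] by auto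
  ultimately show ?thesis using that by blast
qed

section \<open>The series of the zeta function\<close>

definition zeta_term :: "complex \<Rightarrow> complex \<Rightarrow> complex" where
  "zeta_term \<omega> z = 1 / (z - \<omega>) + 1 / \<omega> + z / \<omega>\<^sup>2"

text \<open>The correction terms cancel the expansion of 1 / (z - \<omega>) up to first order in z
  and leave z^2 / (\<omega>^2 (z - \<omega>)), where |z - \<omega>| is at least |\<omega>| /
  2.\<close>

lemma norm_zeta_term_le:
  assumes "2 * norm z \<le> norm \<omega>"
  shows "norm (zeta_term \<omega> z) \<le> 2 * norm z ^ 2 * (1 / norm \<omega> ^ 3)"
proof (cases "\<omega> = 0")
  case True
  thus ?thesis using assms by (simp add: zeta_term_def)
next
  case False
  have "norm (z - \<omega>) \<ge> norm \<omega> - norm z"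
    by (metis norm_minus_commute norm_triangle_ineq2)
  hence half: "norm (z - \<omega>) \<ge> norm \<omega> / 2"
    using assms by linarith
  have pos: "norm (z - \<omega>) > 0"
    using half zero_less_norm_iff[of \<omega>] False by linarith
  hence "zeta_term \<omega> z = z\<^sup>2 / (\<omega>\<^sup>2 * (z - \<omega>))"
    using False by (simp add: zeta_term_def divide_simps) (simp add: power2_eq_square algebra_simps)
  hence "norm (zeta_term \<omega> z) = norm z ^ 2 / (norm \<omega> ^ 2 * norm (z - \<omega>))"
    by (simp add: norm_divide norm_mult norm_power)
  also have "\<dots> \<le> norm z ^ 2 / (norm \<omega> ^ 2 * (norm \<omega> / 2))"
    using half pos False by (intro divide_left_mono mult_left_mono mult_pos_pos) auto
  finally show ?thesis
    by (simp add: power2_eq_square power3_eq_cube mult_ac)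
qed

lemma zeta_term_summable_far:
  assumes "is_lattice \<Lambda>"
  shows "(\<lambda>\<omega>. zeta_term \<omega> z) summable_on {\<omega>\<in>\<Lambda> - {0}. norm \<omega> > 2 * norm z}"
proof (rule abs_summable_summable, rule Infinite_Sum.abs_summable_on_comparison_test)
  have "(\<lambda>\<omega>. 2 * norm z ^ 2 * (1 / norm \<omega> ^ 3)) summable_on {\<omega>\<in>\<Lambda> - {0}. norm \<omega> > 2 * norm z}"
    by (intro summable_on_cmult_right summable_on_subset_banach[OF lattice_summable[OF assms]]) auto
  thus "(\<lambda>\<omega>. norm (2 * norm z ^ 2 * (1 / norm \<omega> ^ 3))) summable_on {\<omega>\<in>\<Lambda> - {0}. norm \<omega> > 2 * norm z}"
    by (simp add: norm_mult norm_divide norm_power)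
next
  fix \<omega> assume "\<omega> \<in> {\<omega>\<in>\<Lambda> - {0}. norm \<omega> > 2 * norm z}"
  thus "norm (zeta_term \<omega> z) \<le> norm (2 * norm z ^ 2 * (1 / norm \<omega> ^ 3))"
    using norm_zeta_term_le[of z \<omega>] by (auto intro: order.trans[OF _ abs_ge_self])
qed

lemma zeta_term_summable:
  assumes "is_lattice \<Lambda>"
  shows "(\<lambda>\<omega>. zeta_term \<omega> z) summable_on \<Lambda>"
proof -
  have "finite {\<omega>\<in>\<Lambda>. norm \<omega> \<le> 2 * norm z}"
    by (rule finite_lattice_cball[OF assms])
  hence "(\<lambda>\<omega>. zeta_term \<omega> z) summable_on
           ({\<omega>\<in>\<Lambda>. norm \<omega> \<le> 2 * norm z} \<union> {\<omega>\<in>\<Lambda> - {0}. norm \<omega> > 2 * norm z})"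
    by (intro summable_on_union zeta_term_summable_far assms summable_on_finite)
  also have "{\<omega>\<in>\<Lambda>. norm \<omega> \<le> 2 * norm z} \<union> {\<omega>\<in>\<Lambda> - {0}. norm \<omega> > 2 * norm z} = \<Lambda>"
    by (auto simp: not_le)
  finally show ?thesis .
qed

text \<open>
  Since \<open>1 / 0 = 0\<close>, the summand for \<open>\<omega> = 0\<close> is the isolated term \<open>1 / z\<close> of the definition.
\<close>

lemma weierstrass_zeta_has_sum:
  assumes "is_lattice \<Lambda>"
  shows "((\<lambda>\<omega>. zeta_term \<omega> z) has_sum weierstrass_zeta \<Lambda> z) \<Lambda>"
proof -
  have "(\<lambda>\<omega>. zeta_term \<omega> z) summable_on (\<Lambda> - {0})"
    by (rule summable_on_subset_banach[OF zeta_term_summable[OF assms]]) auto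
  hence "((\<lambda>\<omega>. zeta_term \<omega> z) has_sum (zeta_term 0 z + infsum (\<lambda>\<omega>. zeta_term \<omega> z) (\<Lambda> - {0})))
          (insert 0 (\<Lambda> - {0}))"
    by (intro has_sum_insert has_sum_infsum) auto
  moreover have "insert 0 (\<Lambda> - {0}) = \<Lambda>"
    using assms by auto
  ultimately show ?thesis
    by (simp add: weierstrass_zeta_def zeta_term_def)
qed

lemma has_sum_diff:
  fixes f g :: "'a \<Rightarrow> complex"
  assumes "(f has_sum a) A" "(g has_sum b) A"
  shows "((\<lambda>x. f x - g x) has_sum (a - b)) A"
  using has_sum_add[OF assms(1) has_sum_uminusI[OF assms(2)]] by simp

text \<open>After reindexing the series at z by \<open>\<omega> - w\<close>, the singular parts
  cancel termwise and the increment \<open>D z\<close> becomes a series of terms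
  \<open>b \<omega> + z * a \<omega>\<close>. So \<open>D z - D 0\<close> is the sum of
  \<open>z * a \<omega>\<close>, and the reflection of \<Lambda> sending \<omega> to
  \<open>w - \<omega>\<close> changes the sign of \<open>a\<close>, which forces that sum to be 0.
  By \<open>1 / 0 = 0\<close> all this also holds at lattice points.\<close>

lemma weierstrass_zeta_quasi_periodic:
  assumes L: "is_lattice \<Lambda>" and w: "w \<in> \<Lambda>"
  obtains \<eta> where "\<And>z. weierstrass_zeta \<Lambda> (z + w) = weierstrass_zeta \<Lambda> z + \<eta>"
proof -
  define D where "D = (\<lambda>z. weierstrass_zeta \<Lambda> (z + w) - weierstrass_zeta \<Lambda> z)"
  define a where "a = (\<lambda>\<omega>. 1 / \<omega>\<^sup>2 - 1 / (\<omega> - w)\<^sup>2)"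
  define b where "b = (\<lambda>\<omega>. 1 / \<omega> + w / \<omega>\<^sup>2 - 1 / (\<omega> - w))"
  have bij: "bij_betw (\<lambda>\<omega>. \<omega> - w) \<Lambda> \<Lambda>" "bij_betw (\<lambda>\<omega>. w - \<omega>) \<Lambda> \<Lambda>"
    by (rule bij_betwI[of _ _ _ "\<lambda>\<omega>. \<omega> + w"]; use L w in \<open>auto intro: lattice_add lattice_diff\<close>)
       (rule bij_betwI[of _ _ _ "\<lambda>\<omega>. w - \<omega>"]; use L w in \<open>auto intro: lattice_add lattice_diff\<close>)
  have D: "((\<lambda>\<omega>. b \<omega> + z * a \<omega>) has_sum D z) \<Lambda>" for z
  proof -
    have "((\<lambda>\<omega>. zeta_term (\<omega> - w) z) has_sum weierstrass_zeta \<Lambda> z) \<Lambda>"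
      using weierstrass_zeta_has_sum[OF L, of z] has_sum_reindex_bij_betw[OF bij(1), where f = "\<lambda>\<omega>. zeta_term \<omega> z"]
      by blast
    from has_sum_diff[OF weierstrass_zeta_has_sum[OF L, of "z + w"] this]
    show ?thesis
      by (simp add: D_def zeta_term_def a_def b_def algebra_simps add_divide_distrib)
  qed
  have "D z = D 0" for z
  proof -
    have *: "((\<lambda>\<omega>. z * a \<omega>) has_sum (D z - D 0)) \<Lambda>"
      using has_sum_diff[OF D[of z] D[of 0]] by simp
    hence "((\<lambda>\<omega>. z * a (w - \<omega>)) has_sum (D z - D 0)) \<Lambda>"
      using has_sum_reindex_bij_betw[OF bij(2), where f = "\<lambda>\<omega>. z * a \<omega>"] by blast
    moreover have "a (w - \<omega>) = - a \<omega>" for \<omega>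
      by (simp add: a_def power2_commute)
    ultimately have "((\<lambda>\<omega>. - (z * a \<omega>)) has_sum (D z - D 0)) \<Lambda>"
      by simp
    hence "((\<lambda>\<omega>. z * a \<omega>) has_sum - (D z - D 0)) \<Lambda>"
      by (simp add: has_sum_uminus)
    with * have "D z - D 0 = - (D z - D 0)"
      by (rule infsumI[symmetric, THEN trans, OF _ infsumI])
    thus ?thesis by simp
  qed
  thus ?thesis
    using that[of "D 0"] by (metis D_def add.commute diff_add_cancel)
qed

lemma mero_rel_zeta: "is_lattice \<Lambda> \<Longrightarrow> mero_rel (weierstrass_zeta \<Lambda>) (weierstrass_zeta \<Lambda>)"
  by (simp add: mero_rel_refl_iff weierstrass_zeta_meromorphic)

lemma mero_zeta_quasi_periodic:
  assumes "is_lattice \<Lambda>" "w \<in> \<Lambda>"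
  obtains \<eta> where "mero_shift w (mero_zeta \<Lambda>) = mero_zeta \<Lambda> + mero_const \<eta>"
proof -
  obtain \<eta> where \<eta>: "\<And>z. weierstrass_zeta \<Lambda> (z + w) = weierstrass_zeta \<Lambda> z + \<eta>"
    using weierstrass_zeta_quasi_periodic[OF assms] by metis
  have "mero_shift w (mero_zeta \<Lambda>) = mero_zeta \<Lambda> + mero_const \<eta>"
    unfolding mero_zeta_def mero_const.abs_eq mero_shift.abs_eq[OF mero_rel_zeta[OF assms(1)]]
      plus_mero.abs_eq[OF mero_rel_zeta[OF assms(1)] mero_rel_refl_iff[THEN iffD2, OF meromorphic_on_const]]
    by (simp add: \<eta>)
  thus ?thesis using that by blast
qed

lemma meromorphic_bounded_imp_analytic:
  assumes "f meromorphic_on UNIV" "\<forall>\<^sub>F z in at z0. norm (f z) \<le> B"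
  obtains g where "g analytic_on {z0}" "\<forall>\<^sub>F z in at z0. f z = g z"
proof -
  have "f meromorphic_on {z0}"
    by (rule meromorphic_on_subset[OF assms(1)]) auto
  hence iso: "isolated_singularity_at f z0" and ne: "not_essential f z0"
    by (auto intro: meromorphic_on_isolated_singularity meromorphic_on_not_essential)
  have "\<not> is_pole f z0"
  proof
    assume "is_pole f z0"
    hence "filterlim (\<lambda>z. norm (f z)) at_top (at z0)"
      unfolding is_pole_def by (rule filterlim_at_infinity_imp_norm_at_top)
    hence "\<forall>\<^sub>F z in at z0. norm (f z) \<ge> B + 1"
      by (simp add: filterlim_at_top)
    with assms(2) have "\<forall>\<^sub>F z in at z0. False"
      by eventually_elim linarith
    thus False by simp
  qed
  then obtain c where "f \<midarrow>z0\<rightarrow> c"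
    using ne by (auto simp: not_essential_def)
  hence "remove_sings f analytic_on {z0}"
    using iso by (intro remove_sings_analytic_at)
  thus ?thesis
    using that eventually_remove_sings_eq_at[OF iso] by (simp add: eq_commute)
qed

text \<open>A bound is enough, since a meromorphic function bounded near \<open>z0\<close> has a
  removable singularity there. The far terms are dominated by a convergent series that does not
  depend on z; the finitely many near terms have limits at \<open>z0\<close> once the pole is
  removed.\<close>

lemma weierstrass_zeta_bounded_near:
  assumes L: "is_lattice \<Lambda>"
  obtains B where
    "\<forall>\<^sub>F z in at z0. norm (weierstrass_zeta \<Lambda> z - (if z0 \<in> \<Lambda> then 1 / (z - z0) else 0)) \<le> B"
proof -
  \<comment> \<open>For |z| < R the far lattice points satisfy 2 |z| \<le> |\<omega>|, as
    \<open>norm_zeta_term_le\<close> requires; \<open>z0\<close> is in the near part if it lies in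
    \<Lambda>.\<close>
  define R where "R = norm z0 + 1"
  define F where "F = {\<omega>\<in>\<Lambda>. norm \<omega> \<le> 2 * R}"
  define G where "G = {\<omega>\<in>\<Lambda> - {0}. norm \<omega> > 2 * R}"
  have "R > 0"
    by (auto simp: R_def intro: add_nonneg_pos)
  have [simp]: "finite F"
    unfolding F_def by (rule finite_lattice_cball[OF L])
  have FG: "\<Lambda> = F \<union> G" "F \<inter> G = {}"
    using L \<open>R > 0\<close> by (auto simp: F_def G_def not_le)
  have M: "(\<lambda>\<omega>. 2 * R ^ 2 * (1 / norm \<omega> ^ 3)) summable_on G"
    by (intro summable_on_cmult_right summable_on_subset_banach[OF lattice_summable[OF L]])
       (auto simp: G_def)
  define B where "B = infsum (\<lambda>\<omega>. 2 * R ^ 2 * (1 / norm \<omega> ^ 3)) G"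
  have far: "norm (infsum (\<lambda>\<omega>. zeta_term \<omega> z) G) \<le> B" if "norm z < R" for z
    unfolding B_def
  proof (rule norm_infsum_le)
    show "((\<lambda>\<omega>. zeta_term \<omega> z) has_sum infsum (\<lambda>\<omega>. zeta_term \<omega> z) G) G"
      by (intro has_sum_infsum summable_on_subset_banach[OF zeta_term_summable[OF L]]) (auto simp: FG)
    show "((\<lambda>\<omega>. 2 * R ^ 2 * (1 / norm \<omega> ^ 3)) has_sum infsum (\<lambda>\<omega>. 2 * R ^ 2 * (1 / norm \<omega> ^ 3)) G) G"
      using M by (rule has_sum_infsum)
    fix \<omega> assume "\<omega> \<in> G"
    hence "norm (zeta_term \<omega> z) \<le> 2 * norm z ^ 2 * (1 / norm \<omega> ^ 3)"
      using that by (intro norm_zeta_term_le) (auto simp: G_def)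
    also have "\<dots> \<le> 2 * R ^ 2 * (1 / norm \<omega> ^ 3)"
      using that by (intro mult_right_mono mult_left_mono power_mono) auto
    finally show "norm (zeta_term \<omega> z) \<le> 2 * R ^ 2 * (1 / norm \<omega> ^ 3)" .
  qed
  have split: "weierstrass_zeta \<Lambda> z = (\<Sum>\<omega>\<in>F. zeta_term \<omega> z) + infsum (\<lambda>\<omega>. zeta_term \<omega> z) G" for z
  proof -
    have "weierstrass_zeta \<Lambda> z = infsum (\<lambda>\<omega>. zeta_term \<omega> z) \<Lambda>"
      using weierstrass_zeta_has_sum[OF L, of z] by (simp add: infsumI)
    also have "\<dots> = infsum (\<lambda>\<omega>. zeta_term \<omega> z) F + infsum (\<lambda>\<omega>. zeta_term \<omega> z) G"
      unfolding FG(1)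
      by (intro infsum_Un_disjoint FG(2) summable_on_subset_banach[OF zeta_term_summable[OF L]])
         (auto simp: FG(1))
    finally show ?thesis by simp
  qed
  define p where "p = (\<lambda>\<omega> z. if \<omega> = z0 then 1 / (z - z0) else 0)"
  have z0_F: "z0 \<in> F \<longleftrightarrow> z0 \<in> \<Lambda>"
    by (auto simp: F_def R_def)
  have near_eq: "(\<Sum>\<omega>\<in>F. zeta_term \<omega> z - p \<omega> z) =
               (\<Sum>\<omega>\<in>F. zeta_term \<omega> z) - (if z0 \<in> \<Lambda> then 1 / (z - z0) else 0)" for z
    by (simp add: sum_subtractf p_def sum.delta z0_F)
  \<comment> \<open>The limits at \<open>z0\<close>; for \<open>\<omega> = z0\<close> the pole is
    cancelled and only the correction terms remain.\<close>
  define l where "l = (\<lambda>\<omega>. if \<omega> = z0 then 1 / \<omega> + z0 / \<omega>\<^sup>2 else zeta_term \<omega> z0)"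
  have "((\<lambda>z. zeta_term \<omega> z - p \<omega> z) \<longlongrightarrow> l \<omega>) (at z0)" for \<omega>
  proof (cases "\<omega> = z0")
    case True
    have "((\<lambda>z. 1 / \<omega> + z / \<omega>\<^sup>2) \<longlongrightarrow> 1 / \<omega> + z0 / \<omega>\<^sup>2) (at z0)"
      by (cases "\<omega> = 0") (auto intro!: tendsto_intros)
    thus ?thesis
      using True by (simp add: zeta_term_def p_def l_def)
  next
    case False
    have "((\<lambda>z. zeta_term \<omega> z) \<longlongrightarrow> zeta_term \<omega> z0) (at z0)"
      unfolding zeta_term_def using False by (cases "\<omega> = 0") (auto intro!: tendsto_intros)
    thus ?thesis
      using False by (simp add: p_def l_def)
  qed
  hence "((\<lambda>z. \<Sum>\<omega>\<in>F. zeta_term \<omega> z - p \<omega> z) \<longlongrightarrow> sum l F) (at z0)"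
    by (rule tendsto_sum)
  hence "\<forall>\<^sub>F z in at z0. norm (\<Sum>\<omega>\<in>F. zeta_term \<omega> z - p \<omega> z) < norm (sum l F) + 1"
    by (intro order_tendstoD(2)[OF tendsto_norm]) auto
  moreover have "\<forall>\<^sub>F z in at z0. z \<in> ball 0 R"
    by (rule eventually_at_in_open') (auto simp: R_def)
  ultimately have
    "\<forall>\<^sub>F z in at z0. norm (weierstrass_zeta \<Lambda> z - (if z0 \<in> \<Lambda> then 1 / (z - z0) else 0))
        \<le> norm (sum l F) + 1 + B"
  proof eventually_elim
    case (elim z)
    have "weierstrass_zeta \<Lambda> z - (if z0 \<in> \<Lambda> then 1 / (z - z0) else 0) =
            (\<Sum>\<omega>\<in>F. zeta_term \<omega> z - p \<omega> z) + infsum (\<lambda>\<omega>. zeta_term \<omega> z) G"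
      unfolding near_eq split by simp
    also have "norm \<dots> \<le> norm (sum l F) + 1 + B"
      using far[of z] elim by (intro order.trans[OF norm_triangle_ineq] add_mono) auto
    finally show ?case .
  qed
  thus ?thesis using that by blast
qed

lemma weierstrass_zeta_expansion:
  assumes L: "is_lattice \<Lambda>"
  obtains g where "g analytic_on {z0}"
    "\<forall>\<^sub>F z in at z0. weierstrass_zeta \<Lambda> z = (if z0 \<in> \<Lambda> then 1 / (z - z0) else 0) + g z"
proof -
  define s :: "complex \<Rightarrow> complex" where "s = (\<lambda>z. if z0 \<in> \<Lambda> then 1 / (z - z0) else 0)"
  have "s meromorphic_on UNIV"
    unfolding s_def by (cases "z0 \<in> \<Lambda>") (auto intro!: meromorphic_intros)
  hence m: "(\<lambda>z. weierstrass_zeta \<Lambda> z - s z) meromorphic_on UNIV"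
    by (intro meromorphic_intros weierstrass_zeta_meromorphic L)
  obtain B where "\<forall>\<^sub>F z in at z0. norm (weierstrass_zeta \<Lambda> z - s z) \<le> B"
    unfolding s_def by (rule weierstrass_zeta_bounded_near[OF L])
  then obtain g where g: "g analytic_on {z0}" "\<forall>\<^sub>F z in at z0. weierstrass_zeta \<Lambda> z - s z = g z"
    by (rule meromorphic_bounded_imp_analytic[OF m])
  have "\<forall>\<^sub>F z in at z0. weierstrass_zeta \<Lambda> z = s z + g z"
    using g(2) by eventually_elim (simp add: algebra_simps)
  thus ?thesis
    by (intro that[OF g(1)]) (simp add: s_def)
qed


section \<open>Elliptic functions and the Riccati equation\<close>

lemma doubly_periodic_entire_const:
  fixes G :: "complex \<Rightarrow> complex"
  assumes L: "is_lattice \<Lambda>" and hol: "G holomorphic_on UNIV"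
    and per: "\<And>\<omega> z. \<omega> \<in> \<Lambda> \<Longrightarrow> G (z + \<omega>) = G z"
  shows "\<exists>k. \<forall>z. G z = k"
proof -
  obtain \<omega>1 \<omega>2 where B: "\<Lambda> = {of_int m * \<omega>1 + of_int n * \<omega>2 | m n. True}"
    "\<forall>x y::real. of_real x * \<omega>1 + of_real y * \<omega>2 = 0 \<longrightarrow> x = 0 \<and> y = 0"
    "\<forall>z. \<exists>x y::real. z = of_real x * \<omega>1 + of_real y * \<omega>2"
    by (rule lattice_basis[OF L])
  define T where "T = (\<lambda>p::real \<times> real. of_real (fst p) * \<omega>1 + of_real (snd p) * \<omega>2)"
  define P where "P = T ` ({0..1} \<times> {0..1})"
  have "compact P"
    unfolding P_def T_def
    by (intro compact_continuous_image continuous_intros compact_Times) auto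
  hence "compact (G ` P)"
    using hol by (intro compact_continuous_image)
      (auto intro: holomorphic_on_imp_continuous_on holomorphic_on_subset)
  moreover have "range G \<subseteq> G ` P"
  proof safe
    fix z
    obtain x y :: real where z: "z = of_real x * \<omega>1 + of_real y * \<omega>2"
      using B(3) by blast
    define \<omega> where "\<omega> = of_int (- \<lfloor>x\<rfloor>) * \<omega>1 + of_int (- \<lfloor>y\<rfloor>) * \<omega>2"
    have "\<omega> \<in> \<Lambda>"
      unfolding \<omega>_def B(1) by blast
    hence "G z = G (z + \<omega>)"
      using per by simp
    also have "z + \<omega> = T (frac x, frac y)"
      by (simp add: z \<omega>_def T_def frac_def algebra_simps)
    finally have "G z = G (T (frac x, frac y))" .
    moreover have "T (frac x, frac y) \<in> P"
      unfolding P_def by (intro imageI) (auto intro: less_imp_le frac_lt_1)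
    ultimately show "G z \<in> G ` P" by auto
  qed
  ultimately have "bounded (range G)"
    using bounded_subset compact_imp_bounded by blast
  from Liouville_theorem[OF hol this] show ?thesis
    by (auto simp: constant_on_def)
qed

text \<open>Periodicity carries the limit at 0 to every lattice point, so \<Lambda> needs checking
  only there. The values of \<open>F\<close> are periodic only off a discrete set; limits are
  periodic everywhere, and by their uniqueness so is the function with its singularities removed, to
  which Liouville's theorem applies.\<close>

lemma elliptic_without_poles_const:
  assumes L: "is_lattice \<Lambda>" and mero: "F meromorphic_on UNIV"
    and per: "\<And>\<omega>. \<omega> \<in> \<Lambda> \<Longrightarrow> \<forall>\<^sub>\<approx>z\<in>UNIV. F (z + \<omega>) = F z"
    and lim: "\<And>z. z \<notin> \<Lambda> \<Longrightarrow> \<exists>c. F \<midarrow>z\<rightarrow> c" and lim0: "\<exists>c. F \<midarrow>0\<rightarrow> c"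
  obtains k where "\<forall>\<^sub>\<approx>z\<in>UNIV. F z = k"
proof -
  have iso: "isolated_singularity_at F z" for z
    by (rule meromorphic_on_isolated_singularity, rule meromorphic_on_subset[OF mero]) auto
  have per': "\<forall>\<^sub>F w in at z. F (w + \<omega>) = F w" if "\<omega> \<in> \<Lambda>" for \<omega> z
    using per[OF that] by (simp add: eventually_cosparse_open_eq)
  have shift_lim: "F \<midarrow>z\<rightarrow> c \<longleftrightarrow> F \<midarrow>z + \<omega>\<rightarrow> c" if "\<omega> \<in> \<Lambda>" for z \<omega> c
  proof -
    have "F \<midarrow>z + \<omega>\<rightarrow> c \<longleftrightarrow> (\<lambda>w. F (w + \<omega>)) \<midarrow>z\<rightarrow> c"
      using LIM_offset[of F c "z + \<omega>" \<omega>] LIM_offset[of "\<lambda>w. F (w + \<omega>)" c z "- \<omega>"] by auto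
    also have "\<dots> \<longleftrightarrow> F \<midarrow>z\<rightarrow> c"
      by (rule filterlim_cong[OF refl refl per'[OF that]])
    finally show ?thesis by simp
  qed
  have lim': "\<exists>c. F \<midarrow>z\<rightarrow> c" for z
    using lim[of z] lim0 shift_lim[of z, where z = 0] by (cases "z \<in> \<Lambda>") auto
  define G where "G = remove_sings F"
  have G: "G analytic_on {z}" for z
    using lim'[of z] iso remove_sings_analytic_at unfolding G_def by blast
  hence hol: "G holomorphic_on UNIV"
    by (meson analytic_imp_holomorphic analytic_on_analytic_at)
  have G_lim: "G \<midarrow>z\<rightarrow> G z" for z
    using G[of z] analytic_at_imp_isCont isContD by blast
  have F_lim: "F \<midarrow>z\<rightarrow> G z" for z
    using G_lim[of z] eventually_remove_sings_eq_at[OF iso[of z]]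
    by (subst filterlim_cong[OF refl refl, of _ G]) (auto simp: G_def eq_commute elim: eventually_mono)
  have "G (z + \<omega>) = G z" if "\<omega> \<in> \<Lambda>" for z \<omega>
    by (rule LIM_unique[OF F_lim iffD1[OF shift_lim[OF that] F_lim]])
  then obtain k where k: "\<And>z. G z = k"
    using doubly_periodic_entire_const[OF L hol] by blast
  have "\<forall>\<^sub>\<approx>z\<in>UNIV. F z = k"
    using eventually_remove_sings_eq[OF mero] k by (simp add: G_def eq_commute)
  thus ?thesis using that by blast
qed

section \<open>Exponentials and the Riccati equation\<close>

lift_definition mero_exp :: "complex \<Rightarrow> mero" is "\<lambda>c z. exp (c * z)"
  by (auto simp: mero_rel_refl_iff intro!: analytic_on_imp_meromorphic_on analytic_intros)

lemma mero_deriv_exp: "mero_deriv (mero_exp c) = mero_const c * mero_exp c"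
proof transfer
  fix c :: complex
  have "deriv (\<lambda>z. exp (c * z)) = (\<lambda>z. c * exp (c * z))"
    by (rule ext, rule DERIV_imp_deriv) (auto intro!: derivative_eq_intros)
  thus "mero_rel (deriv (\<lambda>z. exp (c * z))) (\<lambda>z. c * exp (c * z))"
    by (auto simp: mero_rel_refl_iff intro!: analytic_on_imp_meromorphic_on analytic_intros)
qed

lemma mero_shift_exp: "mero_shift a (mero_exp c) = mero_const (exp (c * a)) * mero_exp c"
proof transfer
  fix a c :: complex
  show "mero_rel (\<lambda>z. exp (c * (z + a))) (\<lambda>z. exp (c * a) * exp (c * z))"
    by (auto simp: mero_rel_refl_iff ring_distribs exp_add mult.commute
             intro!: analytic_on_imp_meromorphic_on analytic_intros)
qed

lemma mero_exp_nonzero: "mero_exp c \<noteq> 0"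
  by transfer (auto simp: mero_rel_def)

text \<open>Both \<open>c * \<omega>1\<close> and \<open>c * \<omega>2\<close> would be integer
  multiples of 2 pi i, which makes the generators dependent over the reals.\<close>

lemma periods_of_exp_not_lattice:
  assumes L: "is_lattice \<Lambda>" and "c \<noteq> 0" and exp: "\<And>\<omega>. \<omega> \<in> \<Lambda> \<Longrightarrow> exp (c * \<omega>) = 1"
  shows False
proof -
  obtain \<omega>1 \<omega>2 where B: "\<Lambda> = {of_int m * \<omega>1 + of_int n * \<omega>2 | m n. True}"
    "\<forall>x y::real. of_real x * \<omega>1 + of_real y * \<omega>2 = 0 \<longrightarrow> x = 0 \<and> y = 0"
    "\<forall>z. \<exists>x y::real. z = of_real x * \<omega>1 + of_real y * \<omega>2"
    by (rule lattice_basis[OF L])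
  have "of_int 1 * \<omega>1 + of_int 0 * \<omega>2 \<in> \<Lambda>" "of_int 0 * \<omega>1 + of_int 1 * \<omega>2 \<in> \<Lambda>"
    unfolding B(1) by blast+
  hence "exp (c * \<omega>1) = 1" "exp (c * \<omega>2) = 1"
    using exp by simp_all
  then obtain m n where m: "c * \<omega>1 = of_int m * (2 * of_real pi * \<i>)"
      and n: "c * \<omega>2 = of_int n * (2 * of_real pi * \<i>)"
    using exp_eq_1 by (auto simp: complex_eq_iff mult_ac)
  have "c * (of_int n * \<omega>1 - of_int m * \<omega>2) = of_int n * (c * \<omega>1) - of_int m * (c * \<omega>2)"
    by (simp add: algebra_simps)
  also have "\<dots> = 0"
    unfolding m n by simp
  finally have "of_real (of_int n) * \<omega>1 + of_real (of_int (- m)) * \<omega>2 = 0"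
    using \<open>c \<noteq> 0\<close> by simp
  hence "of_int n = (0::real) \<and> of_int (- m) = (0::real)"
    using B(2) by blast
  hence "c * \<omega>1 = 0"
    unfolding m by simp
  hence "of_real 1 * \<omega>1 + of_real 0 * \<omega>2 = 0"
    using \<open>c \<noteq> 0\<close> by simp
  thus False
    using B(2) by (metis zero_neq_one)
qed

text \<open>
  If the roots of the right-hand side differ, then the Riccati equation linearises to
  \<open>u' = - (\<alpha> - \<beta>) u\<close> for \<open>u = (f - \<alpha>) / (f - \<beta>)\<close>, otherwise to \<open>u' = 1\<close> for \<open>u = 1 / (f - \<alpha>)\<close>.
\<close>

lemma riccati_no_elliptic_solution:
  assumes L: "is_lattice \<Lambda>" and f: "f \<in> elliptic_field \<Lambda>" and nonconst: "\<And>c. f \<noteq> mero_const c"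
    and riccati: "mero_deriv f = - ((f - mero_const \<alpha>) * (f - mero_const \<beta>))"
  shows False
proof -
  have shift_f: "mero_shift \<omega> f = f" if "\<omega> \<in> \<Lambda>" for \<omega>
    using f that by (auto simp: elliptic_field_def)
  have ne: "f - mero_const c \<noteq> 0" for c
    using nonconst[of c] by simp
  show False
  proof (cases "\<alpha> = \<beta>")
    case True
    define u where "u = inverse (f - mero_const \<alpha>)"
    have "mero_deriv u = 1"
      using ne[of \<alpha>] True riccati
      by (simp add: u_def mero_deriv_inverse mero_deriv_diff power2_eq_square)
    hence "mero_deriv (u - mero_id) = 0"
      by (simp add: mero_deriv_diff)
    then obtain c where "u - mero_id = mero_const c"
      using mero_deriv_eq_0_imp_const by blast
    hence u: "u = mero_const c + mero_id"
      by (simp add: algebra_simps)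
    obtain \<omega> where \<omega>: "\<omega> \<in> \<Lambda>" "\<omega> \<noteq> 0"
      using lattice_nonzero[OF L] .
    have "mero_shift \<omega> u = u"
      using \<omega> by (simp add: u_def mero_shift_inverse mero_shift_diff shift_f)
    thus False
      using \<omega> by (simp add: u mero_shift_add mero_shift_id)
  next
    case False
    define u where "u = (f - mero_const \<alpha>) * inverse (f - mero_const \<beta>)"
    have u': "mero_deriv u = mero_const (\<beta> - \<alpha>) * u"
    proof -
      define a b where "a = f - mero_const \<alpha>" and "b = f - mero_const \<beta>"
      have [simp]: "b \<noteq> 0"
        using ne by (simp add: b_def)
      have d: "mero_deriv a = - (a * b)" "mero_deriv b = - (a * b)"
        by (simp_all add: a_def b_def mero_deriv_diff riccati)
      have u: "u = a * inverse b"
        by (simp add: u_def a_def b_def)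
      have "mero_deriv u = - (a * b) * inverse b + a * (a * b / b\<^sup>2)"
        by (simp add: u mero_deriv_mult mero_deriv_inverse d)
      also have "\<dots> = (a - b) * (a * inverse b)"
        by (simp add: field_simps power2_eq_square)
      also have "a - b = mero_const (\<beta> - \<alpha>)"
        by (simp add: a_def b_def mero_const_diff)
      finally show ?thesis
        by (simp only: u)
    qed
    \<comment> \<open>Dividing \<open>u\<close> by the solution exp((\<beta> - \<alpha>) z) of its
      equation leaves a constant; the periods of \<open>u\<close> then become periods of the
      exponential.\<close>
    have "mero_deriv (u * mero_exp (\<alpha> - \<beta>)) = 0"
      by (simp add: mero_deriv_mult mero_deriv_exp u' mero_const_diff algebra_simps)
    then obtain c where c: "u * mero_exp (\<alpha> - \<beta>) = mero_const c"
      using mero_deriv_eq_0_imp_const by blast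
    have "u \<noteq> 0"
      using ne by (simp add: u_def)
    have "exp ((\<alpha> - \<beta>) * \<omega>) = 1" if "\<omega> \<in> \<Lambda>" for \<omega>
    proof -
      have "mero_shift \<omega> u = u"
        using that by (simp add: u_def mero_shift_inverse mero_shift_diff mero_shift_mult shift_f)
      hence "mero_const (exp ((\<alpha> - \<beta>) * \<omega>)) * (u * mero_exp (\<alpha> - \<beta>)) =
               mero_shift \<omega> (u * mero_exp (\<alpha> - \<beta>))"
        by (simp only: mero_shift_mult mero_shift_exp mult.left_commute)
      also have "\<dots> = u * mero_exp (\<alpha> - \<beta>)"
        by (simp add: c)
      finally have "mero_const (exp ((\<alpha> - \<beta>) * \<omega>)) = mero_const 1"
        using \<open>u \<noteq> 0\<close> mero_exp_nonzero by simp
      thus ?thesis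
        by (simp only: mero_const_eq_iff)
    qed
    thus False
      using periods_of_exp_not_lattice[OF L, of "\<alpha> - \<beta>"] False by auto
  qed
qed


section \<open>Nondegeneracy of the quasi-periods\<close>

text \<open>Near 0 the function is 1/z + h + O(z). In f' + f^2 the double poles cancel because the
  residue is 1, and 2 h f removes the remaining 2 h / z. So f' + f^2 - 2 h f is elliptic without
  poles, hence a constant k.\<close>

lemma zeta_minus_linear_riccati:
  assumes L: "is_lattice \<Lambda>" and f: "f = mero_zeta \<Lambda> - mero_const c * mero_id"
    and per: "f \<in> elliptic_field \<Lambda>"
  obtains \<alpha> \<beta> where "mero_deriv f = - ((f - mero_const \<alpha>) * (f - mero_const \<beta>))"
proof -
  define Z where "Z = (\<lambda>z. weierstrass_zeta \<Lambda> z - c * z)"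
  have Z_rel: "mero_rel Z Z"
    unfolding Z_def mero_rel_refl_iff by (intro meromorphic_intros weierstrass_zeta_meromorphic L)
  have f_eq: "f = abs_mero Z"
    unfolding f mero_zeta_def mero_const.abs_eq mero_id.abs_eq Z_def
    by (subst times_mero.abs_eq; (subst minus_mero.abs_eq)?)
       (auto simp: mero_rel_refl_iff weierstrass_zeta_meromorphic[OF L] intro!: meromorphic_intros)
  obtain g where g: "g analytic_on {0}"
      "\<forall>\<^sub>F z in at 0. weierstrass_zeta \<Lambda> z = (if (0::complex) \<in> \<Lambda> then 1 / (z - 0) else 0) + g z"
    by (rule weierstrass_zeta_expansion[OF L])
  define h where "h = g 0"
  define F where "F = (\<lambda>z. deriv Z z + Z z ^ 2 - 2 * h * Z z)"
  have F_mero: "F meromorphic_on UNIV"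
    using Z_rel unfolding F_def mero_rel_refl_iff by (intro meromorphic_intros) auto
  have per_Z: "\<forall>\<^sub>\<approx>z\<in>UNIV. Z (z + \<omega>) = Z z" if "\<omega> \<in> \<Lambda>" for \<omega>
  proof -
    have "mero_shift \<omega> f = f"
      using per that by (simp add: elliptic_field_def)
    hence "mero_rel (\<lambda>z. Z (z + \<omega>)) Z"
      unfolding f_eq mero_shift.abs_eq[OF Z_rel]
      by (subst (asm) abs_mero_eq_iff)
         (use Z_rel mero_rel_shift_meromorphic[OF Z_rel] in \<open>auto simp: mero_rel_refl_iff\<close>)
    thus ?thesis by (rule mero_relD)
  qed
  have per_F: "\<forall>\<^sub>\<approx>z\<in>UNIV. F (z + \<omega>) = F z" if \<omega>: "\<omega> \<in> \<Lambda>" for \<omega>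
  proof -
    show ?thesis
      using per_Z[OF \<omega>] eventually_cosparse_imp_nhds[OF per_Z[OF \<omega>]]
        mero_relD(3)[OF mero_rel_deriv_affine[OF Z_rel one_neq_zero, of \<omega>]]
    proof eventually_elim
      case (elim z)
      from elim(2) have "deriv (\<lambda>z. Z (z + \<omega>)) z = deriv Z z"
        by (intro deriv_cong_ev) auto
      thus ?case
        using elim by (simp add: F_def)
    qed
  qed
  have ev_deriv: "\<forall>\<^sub>F z in at a. deriv Z z = deriv G z" if "\<forall>\<^sub>F z in at a. Z z = G z" for a G
    using eventually_at_imp_eventually_nhds[OF that]
    by (rule eventually_mono) (auto intro: deriv_cong_ev)
  have lim: "\<exists>l. F \<midarrow>a\<rightarrow> l" if a: "a \<notin> \<Lambda>" for a
  proof -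
    obtain G where G: "G analytic_on {a}" "\<forall>\<^sub>F z in at a. weierstrass_zeta \<Lambda> z = (if a \<in> \<Lambda> then 1 / (z - a) else 0) + G z"
      by (rule weierstrass_zeta_expansion[OF L])
    define H where "H = (\<lambda>z. G z - c * z)"
    have H: "H analytic_on {a}"
      unfolding H_def by (intro analytic_intros G)
    have ev: "\<forall>\<^sub>F z in at a. Z z = H z"
      using G(2) by eventually_elim (simp add: Z_def H_def a)
    have "isCont (\<lambda>z. deriv H z + H z ^ 2 - 2 * h * H z) a"
      by (intro analytic_at_imp_isCont analytic_intros H)
    hence "(\<lambda>z. deriv H z + H z ^ 2 - 2 * h * H z) \<midarrow>a\<rightarrow> deriv H a + H a ^ 2 - 2 * h * H a"
      by (rule isContD)
    moreover have "\<forall>\<^sub>F z in at a. deriv H z + H z ^ 2 - 2 * h * H z = F z"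
      using ev ev_deriv[OF ev] by eventually_elim (simp add: F_def)
    ultimately show ?thesis
      using Lim_transform_eventually by blast
  qed
  have lim0: "\<exists>l. F \<midarrow>0\<rightarrow> l"
  proof -
    define H where "H = (\<lambda>z. g z - c * z)"
    have H: "H analytic_on {0}"
      unfolding H_def by (intro analytic_intros g)
    have H0: "H 0 = h"
      by (simp add: H_def h_def)
    have ev: "\<forall>\<^sub>F z in at 0. Z z = 1 / z + H z"
      using g(2) by eventually_elim (use L in \<open>simp add: Z_def H_def\<close>)
    have an: "\<forall>\<^sub>F z in at 0. H analytic_on {z}"
    proof -
      obtain A where A: "open A" "0 \<in> A" "H holomorphic_on A"
        using H by (auto simp: analytic_at)
      have "\<forall>\<^sub>F z in at 0. z \<in> A"
        using A by (intro eventually_at_in_open') auto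
      thus ?thesis
        by eventually_elim (use A in \<open>auto simp: analytic_at\<close>)
    qed
    have "(H has_field_derivative deriv H 0) (at 0)"
      using H by (rule analytic_derivI)
    \<comment> \<open>With Z = 1/z + H and H(0) = h, the terms of F with a denominator combine to 2
      (H - h) / z, twice a difference quotient.\<close>
    hence quot: "(\<lambda>z. (H z - h) / z) \<midarrow>0\<rightarrow> deriv H 0"
      by (simp add: has_field_derivative_iff H0)
    have "isCont (\<lambda>z. deriv H z + H z ^ 2 - 2 * h * H z) 0"
      by (intro analytic_at_imp_isCont analytic_intros H)
    hence "(\<lambda>z. deriv H z + H z ^ 2 - 2 * h * H z) \<midarrow>0\<rightarrow> deriv H 0 + H 0 ^ 2 - 2 * h * H 0"
      by (rule isContD)
    from tendsto_add[OF this tendsto_mult[OF tendsto_const quot, of 2]]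
    have "(\<lambda>z. (deriv H z + H z ^ 2 - 2 * h * H z) + 2 * ((H z - h) / z)) \<midarrow>0\<rightarrow>
            (deriv H 0 + H 0 ^ 2 - 2 * h * H 0) + 2 * deriv H 0" .
    moreover have "\<forall>\<^sub>F z in at 0. (deriv H z + H z ^ 2 - 2 * h * H z) + 2 * ((H z - h) / z) = F z"
      using ev ev_deriv[OF ev] an eventually_neq_at_within[of 0 0 UNIV]
    proof eventually_elim
      case (elim z)
      have "((\<lambda>z. 1 / z + H z) has_field_derivative (- 1 / z\<^sup>2 + deriv H z)) (at z)"
        using elim analytic_derivI[of H z]
        by (auto intro!: derivative_eq_intros simp: power2_eq_square)
      hence *: "deriv Z z = - 1 / z\<^sup>2 + deriv H z"
        using elim(2) by (simp add: DERIV_imp_deriv)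
      show ?case
        using elim(4) unfolding F_def elim(1) * by (simp add: field_simps power2_eq_square)
    qed
    ultimately show ?thesis
      using Lim_transform_eventually by blast
  qed
  obtain k where k: "\<forall>\<^sub>\<approx>z\<in>UNIV. F z = k"
    by (rule elliptic_without_poles_const[OF L F_mero per_F lim lim0])
  \<comment> \<open>The numbers h + s and h - s are the roots of X^2 - 2 h X - k, the negative of
    the right-hand side of the equation for the derivative of \<open>Z\<close>.\<close>
  define s where "s = csqrt (h\<^sup>2 + k)"
  have "mero_rel (deriv Z) (\<lambda>z. - ((Z z - (h + s)) * (Z z - (h - s))))"
  proof (rule mero_relI)
    show "\<forall>\<^sub>\<approx>z\<in>UNIV. deriv Z z = - ((Z z - (h + s)) * (Z z - (h - s)))"
      using k
    proof eventually_elim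
      case (elim z)
      have "(Z z - (h + s)) * (Z z - (h - s)) = Z z ^ 2 - 2 * h * Z z + h\<^sup>2 - s\<^sup>2"
        by (simp add: algebra_simps power2_eq_square)
      also have "s\<^sup>2 = h\<^sup>2 + k"
        by (simp add: s_def)
      finally have p: "(Z z - (h + s)) * (Z z - (h - s)) = Z z ^ 2 - 2 * h * Z z - k"
        by simp
      have "deriv Z z = k + 2 * h * Z z - Z z ^ 2"
        using elim unfolding F_def by (simp add: algebra_simps)
      thus ?case
        unfolding p by simp
    qed
  qed (use Z_rel in \<open>auto simp: mero_rel_refl_iff intro!: meromorphic_intros\<close>)
  hence "abs_mero (deriv Z) = abs_mero (\<lambda>z. - ((Z z - (h + s)) * (Z z - (h - s))))"
    using Quotient_rel_abs[OF Quotient_mero] by blast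
  also have "\<dots> = - ((f - mero_const (h + s)) * (f - mero_const (h - s)))"
  proof -
    have const: "mero_rel (\<lambda>_. a) (\<lambda>_. a)" for a
      by (simp add: mero_rel_refl_iff meromorphic_intros)
    have diff: "mero_rel (\<lambda>z. Z z - a) (\<lambda>z. Z z - a)" for a
      using Z_rel by (auto simp: mero_rel_refl_iff intro!: meromorphic_intros)
    have prod: "mero_rel (\<lambda>z. (Z z - a) * (Z z - b)) (\<lambda>z. (Z z - a) * (Z z - b))" for a b
      using Z_rel by (auto simp: mero_rel_refl_iff intro!: meromorphic_intros)
    show ?thesis
      unfolding f_eq mero_const.abs_eq
      by (simp only: minus_mero.abs_eq[OF Z_rel const] times_mero.abs_eq[OF diff diff]
            uminus_mero.abs_eq[OF prod])
  qed
  finally have "mero_deriv f = - ((f - mero_const (h + s)) * (f - mero_const (h - s)))"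
    unfolding f_eq mero_deriv.abs_eq[OF Z_rel] .
  thus ?thesis using that by blast
qed

text \<open>Because of the pole at 0, multiplying such an equation by z would equate 1 with a
  function that tends to 0.\<close>

lemma zeta_minus_linear_not_const:
  assumes L: "is_lattice \<Lambda>"
  shows "mero_zeta \<Lambda> - mero_const c * mero_id \<noteq> mero_const d"
proof
  assume eq: "mero_zeta \<Lambda> - mero_const c * mero_id = mero_const d"
  define Z where "Z = weierstrass_zeta \<Lambda>"
  have "mero_zeta \<Lambda> = mero_const c * mero_id + mero_const d"
    using eq by (simp add: algebra_simps)
  also have "mero_const c * mero_id + mero_const d = abs_mero (\<lambda>z. c * z + d)"
    unfolding mero_const.abs_eq mero_id.abs_eq
    by (subst times_mero.abs_eq; (subst plus_mero.abs_eq)?)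
       (auto simp: mero_rel_refl_iff intro!: meromorphic_intros)
  finally have "mero_rel Z (\<lambda>z. c * z + d)"
    unfolding mero_zeta_def Z_def
    by (subst (asm) abs_mero_eq_iff)
       (auto simp: mero_rel_refl_iff weierstrass_zeta_meromorphic[OF L] intro!: meromorphic_intros)
  hence *: "\<forall>\<^sub>F z in at 0. Z z = c * z + d"
    using mero_relD(3) by (fastforce simp: eventually_cosparse_open_eq)
  obtain g where g: "g analytic_on {0}"
      "\<forall>\<^sub>F z in at 0. Z z = (if (0::complex) \<in> \<Lambda> then 1 / (z - 0) else 0) + g z"
    unfolding Z_def by (rule weierstrass_zeta_expansion[OF L])
  have "\<forall>\<^sub>F z in at 0. z * (c * z + d - g z) = 1"
    using * g(2) eventually_neq_at_within[of 0 0 UNIV]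
    by eventually_elim (use L in \<open>auto simp: field_simps\<close>)
  note ev = this
  have "isCont (\<lambda>z. z * (c * z + d - g z)) 0"
    by (intro analytic_at_imp_isCont analytic_intros g)
  hence "(\<lambda>z. z * (c * z + d - g z)) \<midarrow>0\<rightarrow> 0"
    by (auto dest: isContD)
  hence "(\<lambda>z::complex. 1) \<midarrow>0\<rightarrow> (0 :: complex)"
    using tendsto_cong[OF ev] by blast
  thus False
    by (auto dest: LIM_const_eq)
qed

lemma mero_shift_of_int_mult:
  assumes "mero_shift \<omega> f = f"
  shows "mero_shift (of_int m * \<omega>) f = f"
proof -
  have *: "mero_shift (of_nat n * \<omega>) f = f" for n
    by (induction n) (simp_all add: ring_distribs assms flip: mero_shift_shift)
  show ?thesis
  proof (cases m rule: int_cases2)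
    case (nonneg n)
    thus ?thesis using *[of n] by simp
  next
    case (nonpos n)
    have "mero_shift (of_nat n * \<omega>) (mero_shift (of_int m * \<omega>) f) = f"
      unfolding mero_shift_shift by (simp add: nonpos)
    thus ?thesis
      using *[of n] by (metis mero_shift_eq_iff)
  qed
qed

lemma elliptic_fieldI:
  assumes "mero_shift \<omega>1 f = f" "mero_shift \<omega>2 f = f"
  shows "f \<in> elliptic_field {of_int m * \<omega>1 + of_int n * \<omega>2 | m n. True}"
  using assms by (auto simp: elliptic_field_def mero_shift_of_int_mult simp flip: mero_shift_shift)

text \<open>The qualitative part of Legendre's relation, which evaluates this determinant up to sign
  as 2 pi i. If it vanished, one linear function c z would have the same increments as zeta under
  both generators.\<close>

lemma legendre_nondegenerate:
  assumes L: "is_lattice \<Lambda>"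
    and \<Lambda>: "\<Lambda> = {of_int m * \<omega>1 + of_int n * \<omega>2 | m n. True}"
    and \<eta>1: "mero_shift \<omega>1 (mero_zeta \<Lambda>) = mero_zeta \<Lambda> + mero_const \<eta>1"
    and \<eta>2: "mero_shift \<omega>2 (mero_zeta \<Lambda>) = mero_zeta \<Lambda> + mero_const \<eta>2"
    and nz: "\<omega>1 \<noteq> 0"
  shows "\<omega>1 * \<eta>2 \<noteq> \<omega>2 * \<eta>1"
proof
  assume eq: "\<omega>1 * \<eta>2 = \<omega>2 * \<eta>1"
  define c where "c = \<eta>1 / \<omega>1"
  define f where "f = mero_zeta \<Lambda> - mero_const c * mero_id"
  have "c * \<omega>1 = \<eta>1" "c * \<omega>2 = \<eta>2"
    using nz eq by (simp_all add: c_def field_simps)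
  hence "mero_shift \<omega>1 f = f" "mero_shift \<omega>2 f = f"
    by (simp_all add: f_def mero_shift_diff mero_shift_mult mero_shift_id \<eta>1 \<eta>2 ring_distribs
           flip: mero_const_mult)
  hence "f \<in> elliptic_field \<Lambda>"
    unfolding \<Lambda> by (rule elliptic_fieldI)
  from zeta_minus_linear_riccati[OF L f_def this] obtain \<alpha> \<beta>
    where "mero_deriv f = - ((f - mero_const \<alpha>) * (f - mero_const \<beta>))" .
  with \<open>f \<in> _\<close> show False
    using riccati_no_elliptic_solution[OF L, of f \<alpha> \<beta>] zeta_minus_linear_not_const[OF L, of c]
    by (auto simp: f_def)
qed


section \<open>Sublattices and unipotent functions\<close>

lemma is_latticeI:
  assumes "\<forall>x y::real. of_real x * \<omega>1 + of_real y * \<omega>2 = 0 \<longrightarrow> x = 0 \<and> y = 0"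
  shows "is_lattice {of_int m * \<omega>1 + of_int n * \<omega>2 | m n. True}"
proof -
  have *: "x = 0 \<and> y = 0" if "x *\<^sub>R \<omega>1 + y *\<^sub>R \<omega>2 = 0" for x y
    using assms that by (simp add: scaleR_conv_of_real)
  have "\<omega>1 \<noteq> \<omega>2"
    using *[of 1 "-1"] by auto
  moreover have "\<omega>2 \<noteq> 0"
    using *[of 0 1] by auto
  moreover have "\<omega>1 \<notin> span {\<omega>2}"
  proof
    assume "\<omega>1 \<in> span {\<omega>2}"
    then obtain k where "\<omega>1 = k *\<^sub>R \<omega>2"
      by (auto simp: real_vector.span_singleton)
    thus False
      using *[of 1 "- k"] by simp
  qed
  ultimately have "independent {\<omega>1, \<omega>2}"
    by (simp add: real_vector.independent_insert)
  with \<open>\<omega>1 \<noteq> \<omega>2\<close> show ?thesis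
    unfolding is_lattice_def by blast
qed

text \<open>An intersection of two lattices comes without a basis, so indices are studied for bare
  subgroups.\<close>

definition add_subgroup :: "complex set \<Rightarrow> bool" where
  "add_subgroup H \<longleftrightarrow> 0 \<in> H \<and> (\<forall>x\<in>H. \<forall>y\<in>H. x - y \<in> H)"

lemma add_subgroup_of_int_mult:
  assumes "add_subgroup H" "x \<in> H"
  shows "of_int m * x \<in> H"
proof -
  have uminus: "- y \<in> H" if "y \<in> H" for y
    using assms(1) that unfolding add_subgroup_def by (metis diff_0)
  have add: "y + z \<in> H" if "y \<in> H" "z \<in> H" for y z
    using assms(1) that uminus[of z] unfolding add_subgroup_def by (metis diff_minus_eq_add)
  have nat: "of_nat n * x \<in> H" for n
    by (induction n) (use assms add in \<open>auto simp: add_subgroup_def ring_distribs\<close>)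
  show ?thesis
    by (cases m rule: int_cases2) (use nat uminus in auto)
qed

lemma add_subgroup_add: "add_subgroup H \<Longrightarrow> x \<in> H \<Longrightarrow> y \<in> H \<Longrightarrow> x + y \<in> H"
  using add_subgroup_of_int_mult[of H y "-1"] by (force simp: add_subgroup_def)

lemma lattice_add_subgroup: "is_lattice \<Lambda> \<Longrightarrow> add_subgroup \<Lambda>"
  by (auto simp: add_subgroup_def lattice_diff)

lemma add_subgroup_Int: "add_subgroup G \<Longrightarrow> add_subgroup H \<Longrightarrow> add_subgroup (G \<inter> H)"
  by (auto simp: add_subgroup_def)

text \<open>Among the cosets of the multiples of \<open>x\<close> two coincide; the difference of
  the two multiples lies in \<open>H\<close>.\<close>

lemma finite_index_imp_multiple:
  assumes "finite_index H G" "add_subgroup H" "add_subgroup G" "x \<in> G"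
  obtains k :: nat where "k > 0" "of_nat k * x \<in> H"
proof -
  define C where "C = (\<lambda>n::nat. (+) (of_nat n * x) ` H)"
  have "range C \<subseteq> (\<lambda>y. (+) y ` H) ` G"
    using add_subgroup_of_int_mult[OF assms(3,4), of "int _"] by (auto simp: C_def)
  hence "finite (range C)"
    using assms(1) by (auto simp: finite_index_def intro: finite_subset)
  hence "\<not> inj C"
    using finite_imageD infinite_UNIV_nat by blast
  then obtain i j where ij: "i < j" "C i = C j"
    unfolding inj_def by (metis linorder_neqE_nat)
  have "of_nat j * x \<in> C j"
    using assms(2) by (auto simp: C_def add_subgroup_def image_iff)
  then obtain y where y: "y \<in> H" "of_nat j * x = of_nat i * x + y"
    unfolding ij(2)[symmetric] by (auto simp: C_def)
  have "of_nat (j - i) * x = y"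
    using ij y(2) by (simp add: of_nat_diff algebra_simps)
  thus ?thesis
    using that[of "j - i"] ij y(1) by auto
qed

text \<open>Reducing both coordinates modulo \<open>k1\<close> and \<open>k2\<close> gives finitely
  many representatives for the cosets. Thus finite index in a lattice can be tested on two
  generators.\<close>

lemma finite_index_of_multiples:
  assumes G: "G = {of_int m * \<omega>1 + of_int n * \<omega>2 | m n. True}" and "H \<subseteq> G" and H: "add_subgroup H"
    and k: "k1 > 0" "k2 > 0" "of_nat k1 * \<omega>1 \<in> H" "of_nat k2 * \<omega>2 \<in> H"
  shows "finite_index H G"
proof -
  have coset: "(+) x ` H \<subseteq> (+) y ` H" if "x - y \<in> H" for x y
  proof
    fix z assume "z \<in> (+) x ` H"
    then obtain t where t: "t \<in> H" "z = x + t"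
      by auto
    have "z = y + ((x - y) + t)"
      by (simp add: t)
    moreover have "(x - y) + t \<in> H"
      using H that t by (intro add_subgroup_add)
    ultimately show "z \<in> (+) y ` H"
      by blast
  qed
  have "(\<lambda>x. (+) x ` H) ` G \<subseteq>
          (\<lambda>(a, b). (+) (of_int a * \<omega>1 + of_int b * \<omega>2) ` H) ` ({0..<int k1} \<times> {0..<int k2})"
  proof safe
    fix x assume "x \<in> G"
    then obtain m n where x: "x = of_int m * \<omega>1 + of_int n * \<omega>2"
      unfolding G by blast
    define y where "y = of_int (m mod k1) * \<omega>1 + of_int (n mod k2) * \<omega>2"
    have "x - y = of_int (m - m mod k1) * \<omega>1 + of_int (n - n mod k2) * \<omega>2"
      by (simp add: x y_def algebra_simps)
    also have "\<dots> = of_int (m div k1) * (of_nat k1 * \<omega>1) + of_int (n div k2) * (of_nat k2 * \<omega>2)"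
      by (simp add: minus_mod_eq_div_mult)
    also have "\<dots> \<in> H"
      by (intro add_subgroup_add add_subgroup_of_int_mult H k)
    finally have xy: "x - y \<in> H" .
    hence "y - x \<in> H"
      using add_subgroup_of_int_mult[OF H xy, of "-1"] by simp
    hence "(+) x ` H = (+) y ` H"
      using coset xy by blast
    thus "(+) x ` H \<in> (\<lambda>(a, b). (+) (of_int a * \<omega>1 + of_int b * \<omega>2) ` H) ` ({0..<int k1} \<times> {0..<int k2})"
      using k(1,2) by (intro image_eqI[of _ _ "(m mod k1, n mod k2)"]) (auto simp: y_def)
  qed
  hence "finite ((\<lambda>x. (+) x ` H) ` G)"
    by (rule finite_subset) auto
  with assms(2) show ?thesis
    by (simp add: finite_index_def)
qed

lemma lattice_generators:
  "\<omega>1 \<in> {of_int m * \<omega>1 + of_int n * \<omega>2 | m n. True}" (is ?A)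
  "\<omega>2 \<in> {of_int m * \<omega>1 + of_int n * \<omega>2 | m n. True}" (is ?B)
proof -
  have "\<omega>1 = of_int 1 * \<omega>1 + of_int 0 * \<omega>2" "\<omega>2 = of_int 0 * \<omega>1 + of_int 1 * \<omega>2"
    by simp_all
  thus ?A ?B by blast+
qed

text \<open>Ensures that functions periodic only under multiples of the generators still lie in K.
  It suffices that each element of \<Lambda>0, and of the sublattice, has a positive multiple in
  their intersection.\<close>

lemma sublattice_in_commensurability_class:
  assumes L0: "is_lattice \<Lambda>0" and \<Lambda>: "\<Lambda> \<in> commensurability_class \<Lambda>0"
    and basis: "\<Lambda> = {of_int m * \<omega>1 + of_int n * \<omega>2 | m n. True}"
      "\<forall>x y::real. of_real x * \<omega>1 + of_real y * \<omega>2 = 0 \<longrightarrow> x = 0 \<and> y = 0"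
    and N: "N1 > 0" "N2 > 0"
  shows "{of_int m * (of_nat N1 * \<omega>1) + of_int n * (of_nat N2 * \<omega>2) | m n. True}
           \<in> commensurability_class \<Lambda>0"
proof -
  define \<Lambda>' where "\<Lambda>' = {of_int m * (of_nat N1 * \<omega>1) + of_int n * (of_nat N2 * \<omega>2) | m n. True}"
  have L: "is_lattice \<Lambda>" and comm: "finite_index (\<Lambda>0 \<inter> \<Lambda>) \<Lambda>0" "finite_index (\<Lambda>0 \<inter> \<Lambda>) \<Lambda>"
    using \<Lambda> by (auto simp: commensurability_class_def commensurable_def)
  have L': "is_lattice \<Lambda>'"
    unfolding \<Lambda>'_def
  proof (rule is_latticeI, intro allI impI)
    fix x y :: real assume "of_real x * (of_nat N1 * \<omega>1) + of_real y * (of_nat N2 * \<omega>2) = 0"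
    hence "of_real (x * N1) * \<omega>1 + of_real (y * N2) * \<omega>2 = 0"
      by (simp add: mult_ac)
    hence "x * N1 = 0 \<and> y * N2 = 0"
      using basis(2) by blast
    thus "x = 0 \<and> y = 0"
      using N by simp
  qed
  note sub = lattice_add_subgroup[OF L0] lattice_add_subgroup[OF L] lattice_add_subgroup[OF L']
  have sub': "add_subgroup (\<Lambda>0 \<inter> \<Lambda>)" "add_subgroup (\<Lambda>0 \<inter> \<Lambda>')"
    by (intro add_subgroup_Int sub)+
  have multiple: "of_nat (N1 * N2) * x \<in> \<Lambda>'" if x: "x \<in> \<Lambda>" for x
  proof -
    obtain m n where mn: "x = of_int m * \<omega>1 + of_int n * \<omega>2"
      using x unfolding basis(1) by blast
    have "of_nat (N1 * N2) * x =
            of_int (m * int N2) * (of_nat N1 * \<omega>1) + of_int (n * int N1) * (of_nat N2 * \<omega>2)"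
      by (simp add: mn algebra_simps)
    thus ?thesis
      unfolding \<Lambda>'_def by blast
  qed
  have sub_L: "\<Lambda>' \<subseteq> \<Lambda>"
  proof
    fix x assume "x \<in> \<Lambda>'"
    then obtain m n where "x = of_int m * (of_nat N1 * \<omega>1) + of_int n * (of_nat N2 * \<omega>2)"
      unfolding \<Lambda>'_def by blast
    hence "x = of_int (m * int N1) * \<omega>1 + of_int (n * int N2) * \<omega>2"
      by simp
    thus "x \<in> \<Lambda>"
      unfolding basis(1) by blast
  qed
  have mult0: "\<exists>k>0. of_nat k * x \<in> \<Lambda>0 \<inter> \<Lambda>'" if x: "x \<in> \<Lambda>0" for x
  proof -
    obtain k :: nat where k: "k > 0" "of_nat k * x \<in> \<Lambda>0 \<inter> \<Lambda>"
      by (rule finite_index_imp_multiple[OF comm(1) sub'(1) sub(1) x])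
    \<comment> \<open>The factor \<open>k\<close> moves \<open>x\<close> into \<Lambda>, the factor
      \<open>N1 * N2\<close> moves it on into the sublattice.\<close>
    have "of_nat (N1 * N2) * (of_nat k * x) \<in> \<Lambda>'"
      using k multiple by blast
    moreover have "of_int (int (N1 * N2)) * (of_nat k * x) \<in> \<Lambda>0"
      using k by (intro add_subgroup_of_int_mult sub) auto
    ultimately have "of_nat (N1 * N2 * k) * x \<in> \<Lambda>0 \<inter> \<Lambda>'"
      by (simp add: mult.assoc)
    thus ?thesis
      using k N by (intro exI[of _ "N1 * N2 * k"]) auto
  qed
  have mult': "\<exists>k>0. of_nat k * x \<in> \<Lambda>0 \<inter> \<Lambda>'" if x: "x \<in> \<Lambda>'" for x
  proof -
    have "x \<in> \<Lambda>" using sub_L x by blast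
    then obtain k :: nat where k: "k > 0" "of_nat k * x \<in> \<Lambda>0 \<inter> \<Lambda>"
      by (rule finite_index_imp_multiple[OF comm(2) sub'(1) sub(2)])
    moreover have "of_int (int k) * x \<in> \<Lambda>'"
      by (intro add_subgroup_of_int_mult sub x)
    ultimately show ?thesis by auto
  qed
  have "finite_index (\<Lambda>0 \<inter> \<Lambda>') \<Lambda>0"
  proof -
    obtain a b where ab: "\<Lambda>0 = {of_int m * a + of_int n * b | m n. True}"
      using L0 unfolding is_lattice_def by blast
    obtain k1 k2 :: nat where "k1 > 0" "of_nat k1 * a \<in> \<Lambda>0 \<inter> \<Lambda>'" "k2 > 0" "of_nat k2 * b \<in> \<Lambda>0 \<inter> \<Lambda>'"
      using mult0[of a] mult0[of b] lattice_generators[where ?\<omega>1.0 = a and ?\<omega>2.0 = b]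
      unfolding ab[symmetric] by blast
    thus ?thesis
      using sub'(2) by (intro finite_index_of_multiples[OF ab]) auto
  qed
  moreover have "finite_index (\<Lambda>0 \<inter> \<Lambda>') \<Lambda>'"
  proof -
    obtain k1 k2 :: nat where "k1 > 0" "of_nat k1 * (of_nat N1 * \<omega>1) \<in> \<Lambda>0 \<inter> \<Lambda>'"
        "k2 > 0" "of_nat k2 * (of_nat N2 * \<omega>2) \<in> \<Lambda>0 \<inter> \<Lambda>'"
      using mult'[of "of_nat N1 * \<omega>1"] mult'[of "of_nat N2 * \<omega>2"]
        lattice_generators[where ?\<omega>1.0 = "of_nat N1 * \<omega>1" and ?\<omega>2.0 = "of_nat N2 * \<omega>2"]
      unfolding \<Lambda>'_def[symmetric] by blast
    thus ?thesis
      using sub'(2) by (intro finite_index_of_multiples[OF \<Lambda>'_def]) auto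
  qed
  ultimately show ?thesis
    using L' unfolding \<Lambda>'_def[symmetric] by (simp add: commensurability_class_def commensurable_def)
qed

section \<open>Subrings of $M$ and Newton's difference formula\<close>

lemma is_subring_ring_adjoin: "is_subring (ring_adjoin R X)"
  unfolding ring_adjoin_def by (rule hull_in) (auto simp: is_subring_def)

lemma ring_adjoin_superset: "R \<subseteq> ring_adjoin R X" "X \<subseteq> ring_adjoin R X"
  unfolding ring_adjoin_def using hull_subset[of "R \<union> X" is_subring] by auto

lemma subring_uminus: "is_subring R \<Longrightarrow> x \<in> R \<Longrightarrow> - x \<in> R"
  unfolding is_subring_def by (metis diff_0 diff_self)

lemma subring_add: "is_subring R \<Longrightarrow> x \<in> R \<Longrightarrow> y \<in> R \<Longrightarrow> x + y \<in> R"
  using subring_uminus[of R y] unfolding is_subring_def by (metis diff_minus_eq_add)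

lemma subring_prod: "is_subring R \<Longrightarrow> (\<And>i. i \<in> A \<Longrightarrow> f i \<in> R) \<Longrightarrow> prod f A \<in> R"
  by (induction A rule: infinite_finite_induct) (auto simp: is_subring_def)

text \<open>The denominator \<open>fact k\<close> is a nonzero constant, and its inverse lies in the
  subring with the other constants.\<close>

lemma gbinomial_in_subring:
  assumes R: "is_subring R" "range mero_const \<subseteq> R" and x: "x \<in> R"
  shows "x gchoose k \<in> R"
proof -
  have "x gchoose k = (\<Prod>i = 0..<k. x - mero_const (of_nat i)) * mero_const (inverse (fact k))"
    by (simp add: gbinomial_prod_rev mero_const_of_nat mero_const_inverse divide_inverse
          mero_const_of_nat[of "fact k", simplified])
  also have "(\<Prod>i = 0..<k. x - mero_const (of_nat i)) \<in> R"
    using R x by (intro subring_prod) (auto simp: is_subring_def)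
  hence "(\<Prod>i = 0..<k. x - mero_const (of_nat i)) * mero_const (inverse (fact k)) \<in> R"
    using R unfolding is_subring_def by blast
  finally show ?thesis .
qed

lemma mero_shift_gbinomial: "mero_shift v (x gchoose k) = (mero_shift v x gchoose k)"
proof -
  have "mero_shift v (of_nat n) = of_nat n" for n
    by (simp flip: mero_const_of_nat)
  from this[of "fact k"] this have *: "mero_shift v (fact k) = fact k" "\<And>n. mero_shift v (of_nat n) = of_nat n"
    by simp_all
  have prod: "mero_shift v (prod f A) = (\<Prod>i\<in>A. mero_shift v (f i))" for f :: "nat \<Rightarrow> mero" and A
    by (induction A rule: infinite_finite_induct) (auto simp: mero_shift_mult)
  show ?thesis
    by (simp add: gbinomial_prod_rev mero_shift_divide prod mero_shift_diff *)
qed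

definition mdiff :: "complex \<Rightarrow> mero \<Rightarrow> mero" where
  "mdiff v f = mero_shift v f - f"

lemma mdiff_pow_diff: "(mdiff v ^^ d) (f - g) = (mdiff v ^^ d) f - (mdiff v ^^ d) g"
  by (induction d) (simp_all add: mdiff_def mero_shift_diff)

lemma mdiff_pow_mult: "mero_shift v u = u \<Longrightarrow> (mdiff v ^^ d) (u * f) = u * (mdiff v ^^ d) f"
  by (induction d) (simp_all add: mdiff_def mero_shift_mult algebra_simps)

lemma mdiff_pow_shift: "(mdiff v ^^ d) (mero_shift w f) = mero_shift w ((mdiff v ^^ d) f)"
  by (induction d) (simp_all add: mdiff_def mero_shift_diff mero_shift_shift add.commute)

text \<open>By Pascal's rule a difference lowers \<open>x gchoose Suc d\<close> to
  \<open>x gchoose d\<close>, while the periodic factor \<open>g\<close> passes through.\<close>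

lemma mdiff_pow_gbinomial:
  assumes "mero_shift v x = x + 1" "mero_shift v g = g"
  shows "(mdiff v ^^ d) ((x gchoose d) * g) = g"
proof (induction d)
  case (Suc d)
  have "mdiff v ((x gchoose Suc d) * g) = (x gchoose d) * g"
    by (simp add: mdiff_def mero_shift_mult mero_shift_gbinomial assms gbinomial_Suc_Suc ring_distribs)
  thus ?case
    using Suc by (simp add: funpow_Suc_right del: funpow.simps)
qed simp

text \<open>
  Newton's forward difference formula: subtracting \<open>(x gchoose d) * \<Delta>\<^sup>d f\<close> from \<open>f\<close> lowers the
  order of vanishing differences.
\<close>

lemma newton_expansion:
  assumes x: "mero_shift v x = x + 1" and R: "is_subring R" "\<And>k. x gchoose k \<in> R"
    and Q_diff: "\<And>f g. f \<in> Q \<Longrightarrow> g \<in> Q \<Longrightarrow> f - g \<in> Q"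
    and Q_mult: "\<And>k g. g \<in> Q \<Longrightarrow> (x gchoose k) * g \<in> Q"
    and Q_shift: "\<And>g. g \<in> Q \<Longrightarrow> mero_shift v g \<in> Q"
    and Q_R: "\<And>g. g \<in> Q \<Longrightarrow> mero_shift v g = g \<Longrightarrow> g \<in> R"
    and f: "f \<in> Q" "(mdiff v ^^ d) f = 0"
  shows "f \<in> R"
  using f
proof (induction d arbitrary: f)
  case 0
  thus ?case
    using R(1) unfolding is_subring_def by (metis diff_self eq_id_iff funpow_0)
next
  case (Suc d)
  define g where "g = (mdiff v ^^ d) f"
  have "(mdiff v ^^ n) f \<in> Q" for n
    by (induction n) (use Suc.prems Q_diff Q_shift in \<open>auto simp: mdiff_def\<close>)
  hence gQ: "g \<in> Q" by (simp add: g_def)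
  have "mdiff v g = 0"
    using Suc.prems(2) by (simp add: g_def)
  hence g: "mero_shift v g = g"
    by (simp add: mdiff_def)
  have gR: "(x gchoose d) * g \<in> R"
    using R Q_R[OF gQ g] unfolding is_subring_def by blast
  have "f - (x gchoose d) * g \<in> R"
  proof (rule Suc.IH)
    show "f - (x gchoose d) * g \<in> Q"
      by (intro Q_diff Q_mult Suc.prems gQ)
    show "(mdiff v ^^ d) (f - (x gchoose d) * g) = 0"
      by (simp add: mdiff_pow_diff mdiff_pow_gbinomial[OF x g] flip: g_def)
  qed
  from subring_add[OF R(1) this gR] show ?case by simp
qed

text \<open>Newton's formula is nested. The outer expansion in \<open>x\<close> has coefficients
  that are \<open>v\<close>-periodic and still killed by the \<open>e\<close>-th difference in
  direction \<open>w\<close>; the set \<open>Q\<close> there records the latter, and is stable under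
  the binomials in \<open>x\<close> because \<open>x\<close> is \<open>w\<close>-periodic. The inner
  expansion in \<open>y\<close> stays among \<open>v\<close>-periodic functions and ends with
  coefficients periodic in both directions.\<close>

lemma unipotent_imp_in_subring:
  assumes R: "is_subring R" "range mero_const \<subseteq> R"
    and x: "x \<in> R" "mero_shift v x = x + 1" "mero_shift w x = x"
    and y: "y \<in> R" "mero_shift v y = y" "mero_shift w y = y + 1"
    and per: "\<And>g. mero_shift v g = g \<Longrightarrow> mero_shift w g = g \<Longrightarrow> g \<in> R"
    and f: "(mdiff v ^^ d) f = 0" "(mdiff w ^^ e) f = 0"
  shows "f \<in> R"
proof (rule newton_expansion[of v x R "{g. (mdiff w ^^ e) g = 0}"])
  show "g \<in> R" if "g \<in> {g. (mdiff w ^^ e) g = 0}" and g: "mero_shift v g = g" for g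
  proof (rule newton_expansion[of w y R "{g. mero_shift v g = g}"])
    show "mero_shift w h \<in> {g. mero_shift v g = g}" if "h \<in> {g. mero_shift v g = g}" for h
      using that mero_shift_shift[of v w h] mero_shift_shift[of w v h] by (simp add: add.commute)
    show "(y gchoose k) * h \<in> {g. mero_shift v g = g}" if "h \<in> {g. mero_shift v g = g}" for h k
      using that by (simp add: mero_shift_mult mero_shift_gbinomial y)
    show "h \<in> R" if "h \<in> {g. mero_shift v g = g}" "mero_shift w h = h" for h
      using that by (intro per) auto
    show "(mdiff w ^^ e) g = 0" "g \<in> {g. mero_shift v g = g}"
      using that by auto
  qed (use R y in \<open>simp_all add: mero_shift_diff gbinomial_in_subring\<close>)
  show "(x gchoose k) * g \<in> {g. (mdiff w ^^ e) g = 0}" if "g \<in> {g. (mdiff w ^^ e) g = 0}" for g k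
    using that by (simp add: mdiff_pow_mult mero_shift_gbinomial x)
qed (use f R x in \<open>simp_all add: mdiff_pow_diff mdiff_pow_shift gbinomial_in_subring\<close>)


section \<open>The fundamental matrix\<close>

lemma GL_matrix_inv:
  assumes "A \<in> GL R"
  shows "A ** matrix_inv A = mat 1" "matrix_inv A ** A = mat 1"
proof -
  have "\<exists>A'. A ** A' = mat 1 \<and> A' ** A = mat 1"
    using assms unfolding GL_def by blast
  hence "A ** matrix_inv A = mat 1 \<and> matrix_inv A ** A = mat 1"
    unfolding matrix_inv_def by (rule someI_ex)
  thus "A ** matrix_inv A = mat 1" "matrix_inv A ** A = mat 1"
    by simp_all
qed

lemma matrix_add_rdistrib:
  fixes A B C :: "'a::semiring_1 ^ 'n ^ 'n"
  shows "(A + B) ** C = A ** C + B ** C"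
  by (simp add: vec_eq_iff matrix_matrix_mult_def ring_distribs sum.distrib)

lemma gl_elliptic_shift:
  assumes "A \<in> gl (elliptic_field \<Lambda>)" "\<omega> \<in> \<Lambda>"
  shows "map_matrix (mero_shift \<omega>) A = A"
  using assms by (simp add: vec_eq_iff gl_def elliptic_field_def)

text \<open>A translation commutes with the derivation and here fixes the system, so it maps
  solutions to solutions.\<close>

lemma fundamental_matrix_shift:
  fixes B U :: "mero ^ 'n ^ 'n"
  assumes B: "map_matrix (mero_shift w) B = B" and U: "U ** U' = mat 1" "U' ** U = mat 1"
    and ode: "map_matrix mero_deriv U = B ** U"
  obtains M where "map_matrix (mero_shift w) U = U ** map_matrix mero_const M"
proof (rule linear_ode_solutions_differ_by_const[OF U ode])
  have "map_matrix mero_deriv (map_matrix (mero_shift w) U) = map_matrix (mero_shift w) (map_matrix mero_deriv U)"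
    by (simp add: vec_eq_iff mero_deriv_shift)
  thus "map_matrix mero_deriv (map_matrix (mero_shift w) U) = B ** map_matrix (mero_shift w) U"
    by (simp add: ode map_matrix_mult[OF mero_shift_mult mero_shift_sum] B)
qed

text \<open>Both sides solve the system with matrix G = c phi(B): for phi(U) this is the chain rule,
  and for A U it is the consistency relation multiplied by \<open>A\<close> on the right, which
  makes G A equal to A B plus the derivative of \<open>A\<close>.\<close>

lemma fundamental_matrix_dilate:
  fixes A B U :: "mero ^ 'n ^ 'n"
  assumes q: "c \<noteq> 0"
    and A: "A ** A' = mat 1" "A' ** A = mat 1" and U: "U ** U' = mat 1" "U' ** U = mat 1"
    and consistent: "map_matrix (\<lambda>f. mero_const c * mero_dilate c f) B =
           A ** B ** A' + map_matrix mero_deriv A ** A'"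
    and ode: "map_matrix mero_deriv U = B ** U"
  obtains C where "map_matrix (mero_dilate c) U = A ** U ** map_matrix mero_const C"
proof (rule linear_ode_solutions_differ_by_const)
  define G where "G = map_matrix (\<lambda>f. mero_const c * mero_dilate c f) B"
  have GA: "G ** A = A ** B + map_matrix mero_deriv A"
    unfolding G_def consistent
    by (simp add: matrix_add_rdistrib A(2) flip: matrix_mul_assoc)
  have "(A ** U) ** (U' ** A') = A ** (U ** U') ** A'"
    by (simp only: matrix_mul_assoc)
  thus "(A ** U) ** (U' ** A') = mat 1"
    by (simp add: U A)
  have "(U' ** A') ** (A ** U) = U' ** (A' ** A) ** U"
    by (simp only: matrix_mul_assoc)
  thus "(U' ** A') ** (A ** U) = mat 1"
    by (simp add: U A)
  show "map_matrix mero_deriv (A ** U) = G ** (A ** U)"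
    by (simp add: map_matrix_deriv_mult ode matrix_mul_assoc GA matrix_add_rdistrib)
  have "map_matrix mero_deriv (map_matrix (mero_dilate c) U) =
          map_matrix (\<lambda>f. mero_const c * mero_dilate c f) (B ** U)"
    by (simp add: vec_eq_iff mero_deriv_dilate flip: ode)
  thus "map_matrix mero_deriv (map_matrix (mero_dilate c) U) = G ** map_matrix (mero_dilate c) U"
    by (simp add: G_def vec_eq_iff matrix_matrix_mult_def mero_dilate_sum mero_dilate_mult
          sum_distrib_left mult.assoc)
qed

lemma mero_zeta_shift_multiple:
  assumes "mero_shift \<omega> (mero_zeta \<Lambda>) = mero_zeta \<Lambda> + mero_const \<eta>"
  shows "mero_shift (of_nat N * \<omega>) (mero_zeta \<Lambda>) = mero_zeta \<Lambda> + mero_const (of_nat N * \<eta>)"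
proof (induction N)
  case (Suc N)
  have "mero_shift (of_nat (Suc N) * \<omega>) (mero_zeta \<Lambda>) =
          mero_shift \<omega> (mero_shift (of_nat N * \<omega>) (mero_zeta \<Lambda>))"
    by (simp add: mero_shift_shift ring_distribs)
  also have "\<dots> = mero_zeta \<Lambda> + (mero_const \<eta> + mero_const (of_nat N * \<eta>))"
    unfolding Suc by (simp add: mero_shift_add assms add.assoc)
  finally show ?case
    by (simp add: ring_distribs mero_const_add)
qed simp

text \<open>Cramer's rule for a \<omega>1 + b \<eta>1 = 1 and a \<omega>2 + b \<eta>2 = 0; the
  nonvanishing determinant is the nondegeneracy of the quasi-periods.\<close>

lemma shift_dual_pair:
  assumes \<eta>1: "mero_shift \<omega>1 Z = Z + mero_const \<eta>1" and \<eta>2: "mero_shift \<omega>2 Z = Z + mero_const \<eta>2"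
    and nondeg: "\<omega>1 * \<eta>2 \<noteq> \<omega>2 * \<eta>1"
  obtains a b where
    "mero_shift \<omega>1 (mero_const a * mero_id + mero_const b * Z) = mero_const a * mero_id + mero_const b * Z + 1"
    "mero_shift \<omega>2 (mero_const a * mero_id + mero_const b * Z) = mero_const a * mero_id + mero_const b * Z"
proof
  define D where "D = \<omega>1 * \<eta>2 - \<omega>2 * \<eta>1"
  define a b where "a = \<eta>2 / D" and "b = - \<omega>2 / D"
  have "D \<noteq> 0"
    using nondeg by (simp add: D_def)
  have "a * \<omega>1 + b * \<eta>1 = (\<omega>1 * \<eta>2 - \<omega>2 * \<eta>1) / D"
    by (simp add: a_def b_def diff_divide_distrib mult.commute)
  hence 1: "a * \<omega>1 + b * \<eta>1 = 1"
    using \<open>D \<noteq> 0\<close> by (simp add: D_def)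
  have 2: "a * \<omega>2 + b * \<eta>2 = 0"
    by (simp add: a_def b_def)
  have shift: "mero_shift \<omega> (mero_const a * mero_id + mero_const b * Z) =
          mero_const a * mero_id + mero_const b * Z + mero_const (a * \<omega> + b * \<eta>)"
    if "mero_shift \<omega> Z = Z + mero_const \<eta>" for \<omega> \<eta>
    by (simp add: mero_shift_add mero_shift_mult mero_shift_id that mero_const_add mero_const_mult ring_distribs)
  show "mero_shift \<omega>1 (mero_const a * mero_id + mero_const b * Z) = mero_const a * mero_id + mero_const b * Z + 1"
    using shift[OF \<eta>1] by (simp add: 1)
  show "mero_shift \<omega>2 (mero_const a * mero_id + mero_const b * Z) = mero_const a * mero_id + mero_const b * Z"
    using shift[OF \<eta>2] by (simp add: 2)
qed

theorem theorem8p1: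
  fixes \<Lambda>0 \<Lambda> :: "complex set" and q :: int
    and A B U :: "mero ^ 'n ^ 'n"
  assumes "is_lattice \<Lambda>0"
    and "q \<ge> 2"
    and "\<Lambda> \<in> commensurability_class \<Lambda>0"
    and "A \<in> GL (elliptic_field \<Lambda>)"
    and "B \<in> gl (elliptic_field \<Lambda>)"
    and "map_matrix (\<lambda>f. of_int q * mero_dilate (of_int q) f) B =
           A ** B ** matrix_inv A + map_matrix mero_deriv A ** matrix_inv A"
    and "U \<in> GL UNIV"
    and "map_matrix mero_deriv U = B ** U"
  shows "\<forall>i j. U $ i $ j \<in>
           ring_adjoin (elliptic_field_union \<Lambda>0) {mero_id, mero_zeta \<Lambda>}"
proof (intro allI)
  fix i j
  define R where "R = ring_adjoin (elliptic_field_union \<Lambda>0) {mero_id, mero_zeta \<Lambda>}"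
  have R: "is_subring R"
    unfolding R_def by (rule is_subring_ring_adjoin)
  have R_id: "mero_id \<in> R" and R_zeta: "mero_zeta \<Lambda> \<in> R" and R_K: "elliptic_field_union \<Lambda>0 \<subseteq> R"
    using ring_adjoin_superset(1)[of "elliptic_field_union \<Lambda>0" "{mero_id, mero_zeta \<Lambda>}"]
      ring_adjoin_superset(2)[of "{mero_id, mero_zeta \<Lambda>}" "elliptic_field_union \<Lambda>0"]
    unfolding R_def by auto
  have "range mero_const \<subseteq> elliptic_field \<Lambda>"
    by (auto simp: elliptic_field_def)
  hence R_const: "range mero_const \<subseteq> R"
    using R_K assms(3) unfolding elliptic_field_union_def by blast
  have R_comb: "mero_const a * mero_id + mero_const b * mero_zeta \<Lambda> \<in> R" for a b
    using R R_id R_zeta R_const by (intro subring_add) (auto simp: is_subring_def)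

  have L: "is_lattice \<Lambda>"
    using assms(3) by (simp add: commensurability_class_def)
  obtain \<omega>1 \<omega>2 where basis: "\<Lambda> = {of_int m * \<omega>1 + of_int n * \<omega>2 | m n. True}"
    "\<forall>x y::real. of_real x * \<omega>1 + of_real y * \<omega>2 = 0 \<longrightarrow> x = 0 \<and> y = 0"
    "\<forall>z. \<exists>x y::real. z = of_real x * \<omega>1 + of_real y * \<omega>2"
    by (rule lattice_basis[OF L])
  have \<omega>: "\<omega>1 \<in> \<Lambda>" "\<omega>2 \<in> \<Lambda>"
    unfolding basis(1) by (rule lattice_generators)+
  have "\<omega>1 \<noteq> 0"
    using basis(2)[rule_format, of 1 0] by auto
  obtain \<eta>1 where \<eta>1: "mero_shift \<omega>1 (mero_zeta \<Lambda>) = mero_zeta \<Lambda> + mero_const \<eta>1"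
    by (rule mero_zeta_quasi_periodic[OF L \<omega>(1)])
  obtain \<eta>2 where \<eta>2: "mero_shift \<omega>2 (mero_zeta \<Lambda>) = mero_zeta \<Lambda> + mero_const \<eta>2"
    by (rule mero_zeta_quasi_periodic[OF L \<omega>(2)])
  have nondeg: "\<omega>1 * \<eta>2 \<noteq> \<omega>2 * \<eta>1"
    by (rule legendre_nondegenerate[OF L basis(1) \<eta>1 \<eta>2 \<open>\<omega>1 \<noteq> 0\<close>])

  obtain U' where U': "U ** U' = mat 1" "U' ** U = mat 1"
    using GL_matrix_inv[OF assms(7)] by blast
  have A_gl: "A \<in> gl (elliptic_field \<Lambda>)"
    using assms(4) by (simp add: GL_def)
  \<comment> \<open>In p(x^q) the number q is an exponent, hence the passage to a natural
    number.\<close>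
  have q: "of_int q = (of_nat (nat q) :: complex)" "nat q \<ge> 2"
    using assms(2) by simp_all
  have "map_matrix (\<lambda>f. mero_const (of_int q) * mero_dilate (of_int q) f) B =
           A ** B ** matrix_inv A + map_matrix mero_deriv A ** matrix_inv A"
    using assms(6) by (simp add: mero_const_of_int)
  note consistent = this
  have "(of_int q :: complex) \<noteq> 0"
    using assms(2) by simp
  then obtain C where C: "map_matrix (mero_dilate (of_int q)) U = A ** U ** map_matrix mero_const C"
    by (rule fundamental_matrix_dilate[OF _ GL_matrix_inv[OF assms(4)] U' consistent assms(8)])
  have unipotent: "\<exists>N d. N > 0 \<and> (mdiff (of_nat N * \<omega>) ^^ d) (U $ i $ j) = 0" if \<omega>: "\<omega> \<in> \<Lambda>" for \<omega>
  proof -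
    obtain M where M: "map_matrix (mero_shift \<omega>) U = U ** map_matrix mero_const M"
      by (rule fundamental_matrix_shift[OF gl_elliptic_shift[OF assms(5) \<omega>] U' assms(8)])
    show ?thesis
      by (rule shift_quasi_unipotent[OF M C[unfolded q(1)] gl_elliptic_shift[OF A_gl \<omega>] q(2)])
         (auto simp: mdiff_def[abs_def])
  qed
  obtain N1 d1 where N1: "N1 > 0" "(mdiff (of_nat N1 * \<omega>1) ^^ d1) (U $ i $ j) = 0"
    using unipotent[OF \<omega>(1)] by blast
  obtain N2 d2 where N2: "N2 > 0" "(mdiff (of_nat N2 * \<omega>2) ^^ d2) (U $ i $ j) = 0"
    using unipotent[OF \<omega>(2)] by blast

  define v w where "v = of_nat N1 * \<omega>1" and "w = of_nat N2 * \<omega>2"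
  have v: "mero_shift v (mero_zeta \<Lambda>) = mero_zeta \<Lambda> + mero_const (of_nat N1 * \<eta>1)"
    and w: "mero_shift w (mero_zeta \<Lambda>) = mero_zeta \<Lambda> + mero_const (of_nat N2 * \<eta>2)"
    unfolding v_def w_def by (rule mero_zeta_shift_multiple, fact)+
  \<comment> \<open>Passing to multiples only scales the determinant by
    \<open>N1 * N2\<close>.\<close>
  have nondeg_vw: "v * (of_nat N2 * \<eta>2) \<noteq> w * (of_nat N1 * \<eta>1)"
    using nondeg N1(1) N2(1) by (simp add: v_def w_def mult_ac)
  have nondeg_wv: "w * (of_nat N1 * \<eta>1) \<noteq> v * (of_nat N2 * \<eta>2)"
    using nondeg_vw by simp
  obtain x where x: "x \<in> R" "mero_shift v x = x + 1" "mero_shift w x = x"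
    using shift_dual_pair[OF v w nondeg_vw] R_comb by metis
  \<comment> \<open>The same construction with the two translations exchanged.\<close>
  obtain y where y: "y \<in> R" "mero_shift v y = y" "mero_shift w y = y + 1"
    using shift_dual_pair[OF w v nondeg_wv] R_comb by metis
  have "{of_int m * v + of_int n * w | m n. True} \<in> commensurability_class \<Lambda>0"
    unfolding v_def w_def
    by (rule sublattice_in_commensurability_class[OF assms(1,3) basis(1,2) N1(1) N2(1)])
  \<comment> \<open>Here the union over the commensurability class enters: \<open>g\<close> is
    elliptic for the lattice spanned by \<open>v\<close> and \<open>w\<close>, but perhaps not for
    \<Lambda>.\<close>
  hence per: "g \<in> R" if "mero_shift v g = g" "mero_shift w g = g" for g
    using elliptic_fieldI[OF that] R_K unfolding elliptic_field_union_def by blast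
  have "U $ i $ j \<in> R"
    by (rule unipotent_imp_in_subring[OF R R_const x y per])
       (use N1(2) N2(2) in \<open>simp_all add: v_def w_def\<close>)
  thus "U $ i $ j \<in> ring_adjoin (elliptic_field_union \<Lambda>0) {mero_id, mero_zeta \<Lambda>}"
    unfolding R_def .
qed

end
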